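(* There exists an absolute constant $c_1>0$ such that for every $n\ge 1$, every symmetric convex body $K$ in $\mathbf{R}^n$, every orthonormal basis $\{e_1,\ldots,e_n\}$ of $\mathbf{R}^n$ and every $\theta\in(0,1)$ there exists $\sigma\subseteq\{1,\ldots,n\}$ with $|\sigma|\ge(1-\theta)n$ satisfying $$\mathcal{P}_{\sigma}(K)\supseteq\frac{c_1\theta}{\log^2\left(\frac{2}{\theta}\right)h(C_K)M_K}\,D_{\sigma},$$ where $h(y)=y\log(2y)$ for $y\ge1$.
   Context: $\mathbf{R}^n$ carries an inner product $\langle\cdot,\cdot\rangle$ with Euclidean norm $|\cdot|$, unit ball $D_n$ and unit sphere $S^{n-1}$. A symmetric convex body $K$ induces the norm $\|\cdot\|_K$ with unit ball $K$; $M_K=\left(\int_{S^{n-1}}\|x\|_K^2\,d\mu(x)\right)^{1/2}$, where $\mu$ is the rotationally invariant probability measure on $S^{n-1}$. The cotype-2 constant $C_K$ of $(\mathbf{R}^n,\|\cdot\|_K)$ is the smallest $\lambda>0$ such that $\left(\mathrm{Ave}_{\varepsilon_j=\pm1}\|\sum_{j=1}^m\varepsilon_jx_j\|_K^2\right)^{1/2}\ge\frac1\lambda\left(\sum_{j=1}^m\|x_j\|_K^2\right)^{1/2}$ for all $m\in\mathbf{N}$ and all $x_1,\ldots,x_m\in\mathbf{R}^n$. For $\sigma\subseteq\{1,\ldots,n\}$, $|\sigma|$ is its cardinality, $\mathbf{R}^{\sigma}=\{x\in\mathbf{R}^n:\langle x,e_j\rangle=0\text{ if }j\notin\sigma\}$,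 $\mathcal{P}_{\sigma}$ is the orthogonal projection onto $\mathbf{R}^{\sigma}$, and $D_{\sigma}=D_n\cap\mathbf{R}^{\sigma}$. *)

theory Defs
  imports "HOL-Probability.Probability"
begin

(* The dimension has to be quantified inside the statement (the constant must not depend on it),
   so R^n is the carrier of the library's Euclidean_space n: the functions nat => real that
   vanish at all indices i >= n. Vector space operations are written pointwise. *)
abbreviation Rn :: "nat \<Rightarrow> (nat \<Rightarrow> real) set" where
  "Rn n \<equiv> topspace (Euclidean_space n)"

definition inner_Rn :: "nat \<Rightarrow> (nat \<Rightarrow> real) \<Rightarrow> (nat \<Rightarrow> real) \<Rightarrow> real" where
  "inner_Rn n x y = (\<Sum>i<n. x i * y i)"

definition norm_Rn :: "nat \<Rightarrow> (nat \<Rightarrow> real) \<Rightarrow> real" where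
  "norm_Rn n x = sqrt (inner_Rn n x x)"

definition unit_ball :: "nat \<Rightarrow> (nat \<Rightarrow> real) set" where
  "unit_ball n = {x \<in> Rn n. norm_Rn n x \<le> 1}"

definition unit_sphere :: "nat \<Rightarrow> (nat \<Rightarrow> real) set" where
  "unit_sphere n = {x \<in> Rn n. norm_Rn n x = 1}"

definition symmetric_convex_body :: "nat \<Rightarrow> (nat \<Rightarrow> real) set \<Rightarrow> bool" where
  "symmetric_convex_body n K \<longleftrightarrow>
     compactin (Euclidean_space n) K \<and>
     Euclidean_space n interior_of K \<noteq> {} \<and>
     (\<forall>x\<in>K. \<forall>y\<in>K. \<forall>t\<in>{0..1}. (\<lambda>i. (1 - t) * x i + t * y i) \<in> K) \<and>
     (\<forall>x\<in>K. (\<lambda>i. - x i) \<in> K)"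

definition body_norm :: "(nat \<Rightarrow> real) set \<Rightarrow> (nat \<Rightarrow> real) \<Rightarrow> real" where
  "body_norm K x = Inf {t. t > 0 \<and> (\<lambda>i. x i / t) \<in> K}"

definition orthogonal_map :: "nat \<Rightarrow> ((nat \<Rightarrow> real) \<Rightarrow> (nat \<Rightarrow> real)) \<Rightarrow> bool" where
  "orthogonal_map n T \<longleftrightarrow>
     T \<in> Rn n \<rightarrow> Rn n \<and>
     (\<forall>x\<in>Rn n. \<forall>y\<in>Rn n. \<forall>a b. T (\<lambda>i. a * x i + b * y i) = (\<lambda>i. a * T x i + b * T y i)) \<and>
     (\<forall>x\<in>Rn n. \<forall>y\<in>Rn n. inner_Rn n (T x) (T y) = inner_Rn n x y)"

(* There is exactly one such measure for n >= 1. Invariance is under the full orthogonal group,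
   which matters only for n = 1, where SO(1) is trivial. *)
definition rotation_invariant_prob :: "nat \<Rightarrow> (nat \<Rightarrow> real) measure \<Rightarrow> bool" where
  "rotation_invariant_prob n \<mu> \<longleftrightarrow>
     prob_space \<mu> \<and>
     sets \<mu> = sets (restrict_space borel (unit_sphere n)) \<and>
     (\<forall>T. orthogonal_map n T \<longrightarrow> distr \<mu> \<mu> T = \<mu>)"

definition M_const :: "(nat \<Rightarrow> real) measure \<Rightarrow> (nat \<Rightarrow> real) set \<Rightarrow> real" where
  "M_const \<mu> K = sqrt (\<integral>x. (body_norm K x)\<^sup>2 \<partial>\<mu>)"

definition sign_average :: "nat \<Rightarrow> ((nat \<Rightarrow> real) \<Rightarrow> real) \<Rightarrow> real" where
  "sign_average m f = (\<Sum>\<epsilon>\<in>{..<m} \<rightarrow>\<^sub>E {-1, 1}. f \<epsilon>) / 2 ^ m"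

definition is_cotype2_bound :: "nat \<Rightarrow> (nat \<Rightarrow> real) set \<Rightarrow> real \<Rightarrow> bool" where
  "is_cotype2_bound n K L \<longleftrightarrow> L > 0 \<and>
     (\<forall>m. \<forall>x :: nat \<Rightarrow> nat \<Rightarrow> real. (\<forall>j<m. x j \<in> Rn n) \<longrightarrow>
        sqrt (sign_average m (\<lambda>\<epsilon>. (body_norm K (\<lambda>i. \<Sum>j<m. \<epsilon> j * x j i))\<^sup>2))
          \<ge> 1 / L * sqrt (\<Sum>j<m. (body_norm K (x j))\<^sup>2))"

(* For n >= 1 and a symmetric convex body K the set is nonempty and bounded below by 1, and the
   infimum is attained, so this is the smallest bound. *)
definition cotype2_const :: "nat \<Rightarrow> (nat \<Rightarrow> real) set \<Rightarrow> real" where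
  "cotype2_const n K = Inf {L. is_cotype2_bound n K L}"

definition orthonormal_basis :: "nat \<Rightarrow> (nat \<Rightarrow> nat \<Rightarrow> real) \<Rightarrow> bool" where
  "orthonormal_basis n e \<longleftrightarrow>
     (\<forall>j\<in>{1..n}. e j \<in> Rn n) \<and>
     (\<forall>j\<in>{1..n}. \<forall>k\<in>{1..n}. inner_Rn n (e j) (e k) = (if j = k then 1 else 0)) \<and>
     (\<forall>x\<in>Rn n. \<exists>a. x = (\<lambda>i. \<Sum>j=1..n. a j * e j i))"

definition coord_subspace :: "nat \<Rightarrow> (nat \<Rightarrow> nat \<Rightarrow> real) \<Rightarrow> nat set \<Rightarrow> (nat \<Rightarrow> real) set" where
  "coord_subspace n e \<sigma> = {x \<in> Rn n. \<forall>j\<in>{1..n}. j \<notin> \<sigma> \<longrightarrow> inner_Rn n x (e j) = 0}"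

definition orth_proj :: "nat \<Rightarrow> (nat \<Rightarrow> real) set \<Rightarrow> (nat \<Rightarrow> real) \<Rightarrow> (nat \<Rightarrow> real)" where
  "orth_proj n V x = (THE y. y \<in> V \<and> (\<forall>z\<in>V. inner_Rn n (\<lambda>i. x i - y i) z = 0))"

definition h :: "real \<Rightarrow> real" where
  "h y = y * ln (2 * y)"

lemma inner_basis_sum:
  assumes "orthonormal_basis n e" "S \<subseteq> {1..n}" "k \<in> {1..n}"
  shows "inner_Rn n (\<lambda>i. \<Sum>j\<in>S. a j * e j i) (e k) = (if k \<in> S then a k else 0)"
proof -
  have fin: "finite S" using assms(2) finite_subset by blast
  have "inner_Rn n (\<lambda>i. \<Sum>j\<in>S. a j * e j i) (e k) = (\<Sum>j\<in>S. a j * inner_Rn n (e j) (e k))"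
    unfolding inner_Rn_def sum_distrib_right sum_distrib_left
    by (subst sum.swap) (simp add: mult.assoc)
  also have "\<dots> = (\<Sum>j\<in>S. if j = k then a j else 0)"
    using assms by (intro sum.cong) (auto simp: orthonormal_basis_def subset_iff)
  finally show ?thesis using fin by (simp add: sum.delta)
qed

lemma basis_expansion:
  assumes e: "orthonormal_basis n e" and x: "x \<in> Rn n"
  shows "x = (\<lambda>i. \<Sum>j=1..n. inner_Rn n x (e j) * e j i)"
proof -
  obtain a where a: "x = (\<lambda>i. \<Sum>j=1..n. a j * e j i)"
    using e x unfolding orthonormal_basis_def by blast
  have "inner_Rn n x (e k) = a k" if "k \<in> {1..n}" for k
    unfolding a using inner_basis_sum[OF e order_refl that] that by simp
  then have "(\<lambda>i. \<Sum>j=1..n. inner_Rn n x (e j) * e j i) = (\<lambda>i. \<Sum>j=1..n. a j * e j i)"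
    by (intro ext sum.cong) auto
  then show ?thesis using a by simp
qed

lemma orth_proj_coord_subspace:
  assumes e: "orthonormal_basis n e" and s: "\<sigma> \<subseteq> {1..n}" and x: "x \<in> Rn n"
  shows "orth_proj n (coord_subspace n e \<sigma>) x = (\<lambda>i. \<Sum>j\<in>\<sigma>. inner_Rn n x (e j) * e j i)"
  (is "_ = ?p")
  unfolding orth_proj_def
proof (rule the_equality, intro conjI ballI)
  have eR: "e j \<in> Rn n" if "j \<in> {1..n}" for j using e that by (auto simp: orthonormal_basis_def)
  have pR: "?p \<in> Rn n"
    using eR s by (force simp: topspace_Euclidean_space intro!: sum.neutral)
  have pe: "inner_Rn n ?p (e k) = (if k \<in> \<sigma> then inner_Rn n x (e k) else 0)" if "k \<in> {1..n}" for k
    using inner_basis_sum[OF e s that] by simp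
  show pV: "?p \<in> coord_subspace n e \<sigma>"
    using pR pe by (auto simp: coord_subspace_def)
  have diff: "inner_Rn n (\<lambda>i. u i - v i) z = inner_Rn n u z - inner_Rn n v z" for u v z
    by (simp add: inner_Rn_def left_diff_distrib sum_subtractf)
  have expand: "inner_Rn n w z = (\<Sum>j=1..n. inner_Rn n z (e j) * inner_Rn n w (e j))"
    if "z \<in> Rn n" for w z
  proof -
    have "inner_Rn n w z = inner_Rn n w (\<lambda>i. \<Sum>j=1..n. inner_Rn n z (e j) * e j i)"
      using basis_expansion[OF e that] by simp
    also have "\<dots> = (\<Sum>j=1..n. inner_Rn n z (e j) * inner_Rn n w (e j))"
      unfolding inner_Rn_def[of n w] sum_distrib_left
      by (subst sum.swap) (simp add: mult_ac)
    finally show ?thesis .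
  qed
  show "inner_Rn n (\<lambda>i. x i - ?p i) z = 0" if z: "z \<in> coord_subspace n e \<sigma>" for z
  proof -
    have zR: "z \<in> Rn n" using z by (simp add: coord_subspace_def)
    have "inner_Rn n z (e j) * inner_Rn n (\<lambda>i. x i - ?p i) (e j) = 0" if "j \<in> {1..n}" for j
      using z that pe[OF that] diff[of x ?p] by (auto simp: coord_subspace_def)
    then show ?thesis
      unfolding expand[OF zR] by (intro sum.neutral) blast
  qed
  show "y = ?p"
    if y: "y \<in> coord_subspace n e \<sigma> \<and> (\<forall>z\<in>coord_subspace n e \<sigma>. inner_Rn n (\<lambda>i. x i - y i) z = 0)"
    for y
  proof -
    have yR: "y \<in> Rn n" using y by (simp add: coord_subspace_def)
    have ej: "e j \<in> coord_subspace n e \<sigma>" if "j \<in> \<sigma>" for j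
      using that s e eR by (auto simp: coord_subspace_def orthonormal_basis_def subset_iff)
    have "inner_Rn n y (e j) = inner_Rn n x (e j)" if "j \<in> \<sigma>" for j
      using y ej[OF that] diff[of x y "e j"] by force
    moreover have "inner_Rn n y (e j) = 0" if "j \<in> {1..n} - \<sigma>" for j
      using y that by (auto simp: coord_subspace_def)
    ultimately have "(\<Sum>j=1..n. inner_Rn n y (e j) * e j i) = ?p i" for i
      using s by (intro sum.mono_neutral_cong_right) auto
    then show ?thesis using basis_expansion[OF e yR] by presburger
  qed
qed

end

theory Submission
  imports Defs "Jordan_Normal_Form.Determinant"
begin

text \<open>
  Let \<open>B = 3 n C\<^sup>2 M\<^sup>2\<close> (up to the choice of a near-optimal cotype constant \<open>C\<close>). Averaging the squared
  norm over the rotations \<open>w \<mapsto> \<Sum>\<^sub>j \<epsilon>\<^sub>j \<langle>w, x\<^bsub>j+s\<^esub>\<rangle> x\<^sub>j\<close> of an orthonormal basis \<open>x\<close>, over all signs \<open>\<epsilon>\<close>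
  and cyclic shifts \<open>s\<close>, and using cotype 2, every orthonormal system satisfies \<open>\<Sum>\<^sub>j \<parallel>x\<^sub>j\<parallel>\<^sup>2 \<le> B\<close>. Hence a
  maximal orthonormal system with \<open>\<parallel>x\<^sub>j\<parallel> > a\<close>, where \<open>a\<^sup>2\<close> is a large multiple of \<open>B / (\<theta> n)\<close>, has
  \<open>k \<le> \<theta> n / 1024\<close> members, and on the orthogonal complement of its span \<open>H\<close> the norm is at most
  \<open>a |\<cdot>|\<close>.

  The coordinate vectors projected to \<open>H\<close> form a tight frame of \<open>n\<close> vectors in dimension \<open>k\<close>. A one-sided
  barrier argument in the style of Batson, Spielman and Srivastava selects a set \<open>\<tau>\<close> of at most \<open>\<theta> n\<close>
  coordinates whose frame operator is bounded below by \<open>\<theta> / 16\<close>. Every \<open>u\<close> supported on the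
  complement \<open>\<sigma>\<close> of \<open>\<tau>\<close> can therefore be corrected by a vector supported on \<open>\<tau>\<close> so as to become
  orthogonal to \<open>H\<close>, at the cost of a factor of order \<open>\<theta>\<^bsup>-1/2\<^esup>\<close> in Euclidean norm. The
  corrected vector has the same projection \<open>u\<close> and norm at most a multiple of \<open>C M |u| / \<theta>\<close>.
\<close>

section \<open>Symmetric matrices and their inverses\<close>

text \<open>Matrices are plain functions of two indices, with the size \<open>k\<close> passed
  separately. Values at indices from \<open>k\<close> on are meaningless, so inverse identities
  carry the condition \<open>a < k\<close>.\<close>

definition app :: "nat \<Rightarrow> (nat \<Rightarrow> nat \<Rightarrow> real) \<Rightarrow> (nat \<Rightarrow> real) \<Rightarrow> nat \<Rightarrow> real" where
  "app k B x a = (\<Sum>b<k. B a b * x b)"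

definition bil :: "nat \<Rightarrow> (nat \<Rightarrow> nat \<Rightarrow> real) \<Rightarrow> (nat \<Rightarrow> real) \<Rightarrow> (nat \<Rightarrow> real) \<Rightarrow> real" where
  "bil k B x y = inner_Rn k x (app k B y)"

definition tr :: "nat \<Rightarrow> (nat \<Rightarrow> nat \<Rightarrow> real) \<Rightarrow> real" where
  "tr k W = (\<Sum>a<k. W a a)"

text \<open>The squared Hilbert-Schmidt norm. For symmetric \<open>W\<close> it is the trace of the
  square of \<open>W\<close>, hence the rate at which the trace of an inverse \<open>W\<close> grows
  when a multiple of the identity is subtracted from the matrix.\<close>

definition hs :: "nat \<Rightarrow> (nat \<Rightarrow> nat \<Rightarrow> real) \<Rightarrow> real" where
  "hs k W = (\<Sum>a<k. \<Sum>b<k. (W a b)\<^sup>2)"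

text \<open>A kernel vector of the matrix version of \<open>B\<close> would be killed by
  \<open>app k B\<close>. So the determinant is nonzero and the matrix is a unit of the matrix ring;
  its inverse is read back as a function.\<close>

lemma right_inverse_exists:
  fixes B :: "nat \<Rightarrow> nat \<Rightarrow> real"
  assumes inj: "\<And>x. \<forall>a<k. app k B x a = 0 \<Longrightarrow> \<forall>a<k. x a = 0"
  shows "\<exists>W. \<forall>a<k. \<forall>c<k. (\<Sum>b<k. B a b * W b c) = of_bool (a = c) \<and>
    (\<Sum>b<k. W a b * B b c) = of_bool (a = c)"
proof -
  define M where "M = mat k k (\<lambda>(i, j). B i j)"
  have M: "M \<in> carrier_mat k k" by (simp add: M_def)
  have "det M \<noteq> 0"
  proof
    assume "det M = 0"
    then obtain v where v: "v \<in> carrier_vec k" "v \<noteq> 0\<^sub>v k" "M *\<^sub>v v = 0\<^sub>v k"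
      using det_0_iff_vec_prod_zero_field[OF M] by blast
    have "app k B (\<lambda>i. v $ i) a = 0" if "a < k" for a
    proof -
      have "(M *\<^sub>v v) $ a = 0" using v(3) that by simp
      then show ?thesis using that v(1)
        by (simp add: M_def app_def scalar_prod_def atLeast0LessThan)
    qed
    then have "v $ a = 0" if "a < k" for a using inj that by blast
    then have "v = 0\<^sub>v k" using v(1) by auto
    then show False using v(2) by blast
  qed
  then have "M \<in> Units (ring_mat TYPE(real) k ())" by (rule det_non_zero_imp_unit[OF M])
  then obtain N where N: "N \<in> carrier_mat k k" "M * N = 1\<^sub>m k" "N * M = 1\<^sub>m k"
    by (auto simp: Units_def ring_mat_def)
  show ?thesis
  proof (intro exI[of _ "\<lambda>a b. N $$ (a, b)"] allI impI conjI)
    fix a c assume ac: "a < k" "c < k"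
    have "(M * N) $$ (a, c) = of_bool (a = c)" "(N * M) $$ (a, c) = of_bool (a = c)"
      using N ac by auto
    then show "(\<Sum>b<k. B a b * (N $$ (b, c))) = of_bool (a = c)"
       "(\<Sum>b<k. N $$ (a, b) * B b c) = of_bool (a = c)"
      using ac N(1) by (auto simp: M_def scalar_prod_def atLeast0LessThan)
  qed
qed

lemma inner_commute: "inner_Rn k x y = inner_Rn k y x"
  by (simp add: inner_Rn_def mult.commute)

lemma inner_linear:
  "inner_Rn k (\<lambda>i. x i + y i) z = inner_Rn k x z + inner_Rn k y z"
  "inner_Rn k (\<lambda>i. x i - y i) z = inner_Rn k x z - inner_Rn k y z"
  "inner_Rn k (\<lambda>i. c * x i) z = c * inner_Rn k x z"
  "inner_Rn k z (\<lambda>i. x i + y i) = inner_Rn k z x + inner_Rn k z y"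
  "inner_Rn k z (\<lambda>i. x i - y i) = inner_Rn k z x - inner_Rn k z y"
  "inner_Rn k z (\<lambda>i. c * x i) = c * inner_Rn k z x"
  by (simp_all add: inner_Rn_def algebra_simps sum.distrib sum_subtractf sum_distrib_left)

lemma inner_self_nonneg: "0 \<le> inner_Rn k x x"
  by (simp add: inner_Rn_def sum_nonneg)

lemma inner_self_eq_0: "inner_Rn k x x = 0 \<longleftrightarrow> (\<forall>i<k. x i = 0)"
  by (auto simp: inner_Rn_def sum_nonneg_eq_0_iff)

lemma inner_cong:
  "(\<And>i. i < k \<Longrightarrow> x i = x' i) \<Longrightarrow> (\<And>i. i < k \<Longrightarrow> y i = y' i) \<Longrightarrow> inner_Rn k x y = inner_Rn k x' y'"
  by (simp add: inner_Rn_def)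

lemma inner_Cauchy_Schwarz: "(inner_Rn k x y)\<^sup>2 \<le> inner_Rn k x x * inner_Rn k y y"
  using Cauchy_Schwarz_ineq_sum[of x y "{..<k}"] by (simp add: inner_Rn_def power2_eq_square)

lemma app_linear:
  "app k B (\<lambda>i. x i + y i) = (\<lambda>a. app k B x a + app k B y a)"
  "app k B (\<lambda>i. c * x i) = (\<lambda>a. c * app k B x a)"
  by (auto simp: app_def algebra_simps sum.distrib sum_distrib_left)

lemma bil_linear:
  "bil k B (\<lambda>i. x i + y i) z = bil k B x z + bil k B y z"
  "bil k B (\<lambda>i. c * x i) z = c * bil k B x z"
  "bil k B z (\<lambda>i. x i + y i) = bil k B z x + bil k B z y"
  "bil k B z (\<lambda>i. c * x i) = c * bil k B z x"
  by (simp_all add: bil_def inner_linear app_linear)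

lemma bil_sum: "bil k B x y = (\<Sum>a<k. \<Sum>b<k. x a * B a b * y b)"
  by (simp add: bil_def inner_Rn_def app_def sum_distrib_left mult.assoc)

lemma bil_commute:
  assumes "\<And>a b. B a b = B b a"
  shows "bil k B x y = bil k B y x"
proof -
  have "bil k B x y = (\<Sum>b<k. \<Sum>a<k. x a * B a b * y b)"
    unfolding bil_sum by (rule sum.swap)
  also have "\<dots> = bil k B y x"
    unfolding bil_sum
  proof (intro sum.cong refl)
    fix a b
    show "x b * B b a * y a = y a * B a b * x b" using assms[of a b] by simp
  qed
  finally show ?thesis .
qed

text \<open>The form at \<open>x + t y\<close> is a nonnegative quadratic polynomial in
  \<open>t\<close>. The form is only semidefinite, so it may vanish at a nonzero \<open>y\<close>;
  the polynomial is then affine and must be constant.\<close>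

lemma bil_Cauchy_Schwarz:
  assumes sym: "\<And>a b. B a b = B b a" and psd: "\<And>x. 0 \<le> bil k B x x"
  shows "(bil k B x y)\<^sup>2 \<le> bil k B x x * bil k B y y"
proof -
  have q: "0 \<le> bil k B x x + 2 * t * bil k B x y + t\<^sup>2 * bil k B y y" for t
    using psd[of "\<lambda>i. x i + t * y i"] bil_commute[of B k x y, OF sym]
    by (simp add: bil_linear algebra_simps power2_eq_square)
  show ?thesis
  proof (cases "bil k B y y = 0")
    case True
    have "bil k B x y = 0"
    proof (rule ccontr)
      assume "bil k B x y \<noteq> 0"
      \<comment> \<open>At this \<open>t\<close> the affine polynomial takes the value -1.\<close>
      then show False using q[of "- (bil k B x x + 1) / (2 * bil k B x y)"] True
        by (simp add: field_simps)
    qed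
    then show ?thesis using True by simp
  next
    case False
    then have p: "0 < bil k B y y" using psd[of y] by simp
    show ?thesis using q[of "- bil k B x y / bil k B y y"] p
      by (simp add: field_simps power2_eq_square)
  qed
qed

lemma app_basis: "c < k \<Longrightarrow> app k W (\<lambda>i. of_bool (i = c)) a = W a c"
  by (simp add: app_def of_bool_def if_distrib[of "(*) _"] cong: if_cong)

lemma inner_basis: "a < k \<Longrightarrow> inner_Rn k (\<lambda>i. of_bool (i = a)) x = x a"
  by (simp add: inner_Rn_def of_bool_def if_distrib[of "\<lambda>x. x * _"] cong: if_cong)

lemma bil_basis: "a < k \<Longrightarrow> c < k \<Longrightarrow> bil k W (\<lambda>i. of_bool (i = a)) (\<lambda>i. of_bool (i = c)) = W a c"
  by (simp add: bil_def inner_basis app_basis)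

text \<open>The trace bounds the largest eigenvalue, without spectral theory: Cauchy-Schwarz for the
  form bounds each entry by the square roots of two diagonal entries, which turns the double sum
  into a square, and a second Cauchy-Schwarz splits off the trace.\<close>

lemma bil_le_tr:
  assumes sym: "\<And>a b. W a b = W b a" and psd: "\<And>x. 0 \<le> bil k W x x"
  shows "bil k W x x \<le> tr k W * inner_Rn k x x"
proof -
  have d: "0 \<le> W a a" if "a < k" for a using psd[of "\<lambda>i. of_bool (i = a)"] bil_basis[OF that that, of W] by simp
  have e: "\<bar>W a b\<bar> \<le> sqrt (W a a) * sqrt (W b b)" if "a < k" "b < k" for a b
  proof -
    have "(W a b)\<^sup>2 \<le> W a a * W b b"
      using bil_Cauchy_Schwarz[of W k "\<lambda>i. of_bool (i = a)" "\<lambda>i. of_bool (i = b)", OF sym psd] that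
      by (simp add: bil_basis)
    then have "sqrt ((W a b)\<^sup>2) \<le> sqrt (W a a * W b b)" by (rule real_sqrt_le_mono)
    then show ?thesis by (simp add: real_sqrt_mult)
  qed
  have "bil k W x x \<le> (\<Sum>a<k. \<Sum>b<k. (\<bar>x a\<bar> * sqrt (W a a)) * (\<bar>x b\<bar> * sqrt (W b b)))"
    unfolding bil_sum
  proof (intro sum_mono)
    fix a b assume "a \<in> {..<k}" "b \<in> {..<k}"
    then have "\<bar>x a\<bar> * \<bar>x b\<bar> * \<bar>W a b\<bar> \<le> \<bar>x a\<bar> * \<bar>x b\<bar> * (sqrt (W a a) * sqrt (W b b))"
      by (intro mult_left_mono e) auto
    moreover have "x a * W a b * x b \<le> \<bar>x a\<bar> * \<bar>x b\<bar> * \<bar>W a b\<bar>"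
      using abs_ge_self[of "x a * W a b * x b"] by (simp add: abs_mult mult_ac)
    ultimately show "x a * W a b * x b \<le> \<bar>x a\<bar> * sqrt (W a a) * (\<bar>x b\<bar> * sqrt (W b b))"
      by (simp add: mult_ac)
  qed
  also have "\<dots> = (\<Sum>a<k. \<bar>x a\<bar> * sqrt (W a a))\<^sup>2"
    by (simp add: power2_eq_square sum_product)
  also have "\<dots> \<le> (\<Sum>a<k. \<bar>x a\<bar>\<^sup>2) * (\<Sum>a<k. (sqrt (W a a))\<^sup>2)"
    by (rule Cauchy_Schwarz_ineq_sum)
  also have "\<dots> = tr k W * inner_Rn k x x"
    using d by (simp add: tr_def inner_Rn_def power2_eq_square[symmetric])
  finally show ?thesis .
qed

text \<open>Semidefiniteness together with the right inverse amounts to positive definiteness.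
  Symmetry is required at all indices, so it can be used without range conditions.\<close>

definition spd_inverse :: "nat \<Rightarrow> (nat \<Rightarrow> nat \<Rightarrow> real) \<Rightarrow> (nat \<Rightarrow> nat \<Rightarrow> real) \<Rightarrow> bool" where
  "spd_inverse k B W \<longleftrightarrow> (\<forall>a b. B a b = B b a) \<and> (\<forall>a b. W a b = W b a) \<and>
     (\<forall>a<k. \<forall>c<k. (\<Sum>b<k. B a b * W b c) = of_bool (a = c)) \<and> (\<forall>x. 0 \<le> bil k B x x)"

lemma spd_inverse_exists:
  assumes sym: "\<And>a b. B a b = B b a"
    and pd: "\<And>x. d * inner_Rn k x x \<le> bil k B x x" and d: "0 < d"
  obtains W where "spd_inverse k B W"
proof -
  have inj: "\<forall>a<k. x a = 0" if "\<forall>a<k. app k B x a = 0" for x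
  proof -
    have "bil k B x x = 0" using that by (simp add: bil_def inner_Rn_def)
    then have "inner_Rn k x x \<le> 0" using pd[of x] d by (simp add: mult_le_0_iff)
    then have "inner_Rn k x x = 0" using inner_self_nonneg[of k x] by simp
    then show ?thesis using that by (simp add: inner_self_eq_0)
  qed
  obtain W where "\<forall>a<k. \<forall>c<k. (\<Sum>b<k. B a b * W b c) = of_bool (a = c) \<and>
      (\<Sum>b<k. W a b * B b c) = of_bool (a = c)"
    using right_inverse_exists[of k B, OF inj] by blast
  then have W: "\<And>a c. a < k \<Longrightarrow> c < k \<Longrightarrow> (\<Sum>b<k. B a b * W b c) = of_bool (a = c)"
    "\<And>a c. a < k \<Longrightarrow> c < k \<Longrightarrow> (\<Sum>b<k. W a b * B b c) = of_bool (a = c)" by auto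
  \<comment> \<open>Both evaluations of \<open>W\<close> times \<open>B\<close> times the transpose
    of \<open>W\<close> are compared: since \<open>B\<close> is symmetric, one gives
    \<open>W\<close> and the other its transpose.\<close>
  have WT: "W a c = W c a" if "a < k" "c < k" for a c
  proof -
    have "(\<Sum>b<k. \<Sum>j<k. W a b * B b j * W c j) = (\<Sum>b<k. W a b * of_bool (b = c))"
    proof (intro sum.cong refl)
      fix b assume "b \<in> {..<k}"
      then have "(\<Sum>j<k. W c j * B j b) = of_bool (c = b)" using W(2) that by auto
      moreover have "(\<Sum>j<k. W c j * B j b) = (\<Sum>j<k. B b j * W c j)"
        by (intro sum.cong refl) (metis sym mult.commute)
      ultimately have "(\<Sum>j<k. B b j * W c j) = of_bool (b = c)" by auto
      then show "(\<Sum>j<k. W a b * B b j * W c j) = W a b * of_bool (b = c)"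
        by (simp add: sum_distrib_left[symmetric] mult.assoc)
    qed
    also have "\<dots> = W a c" using that by (simp add: of_bool_def if_distrib[of "(*) _"] cong: if_cong)
    finally have 1: "(\<Sum>b<k. \<Sum>j<k. W a b * B b j * W c j) = W a c" .
    have "(\<Sum>b<k. \<Sum>j<k. W a b * B b j * W c j) = (\<Sum>j<k. (\<Sum>b<k. W a b * B b j) * W c j)"
      by (subst sum.swap) (simp add: sum_distrib_right)
    also have "\<dots> = (\<Sum>j<k. of_bool (a = j) * W c j)" using W(2) that by (intro sum.cong) auto
    also have "\<dots> = W c a" using that by (simp add: of_bool_def if_distrib[of "\<lambda>x. x * _"] cong: if_cong)
    finally show ?thesis using 1 by simp
  qed
  \<comment> \<open>Cutting off outside the \<open>k\<close> by \<open>k\<close> block extends the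
    symmetry to all indices.\<close>
  define W' where "W' a b = (if a < k \<and> b < k then W a b else 0)" for a b
  have "0 \<le> bil k B x x" for x
    using pd[of x] mult_nonneg_nonneg[of d, OF _ inner_self_nonneg[of k x]] d by linarith
  then have "spd_inverse k B W'"
    using sym W(1) WT by (auto simp: spd_inverse_def W'_def)
  then show ?thesis by (rule that)
qed

context
  fixes k B W assumes inv: "spd_inverse k B W"
begin

lemma spd_sym: "B a b = B b a" "W a b = W b a"
  using inv by (auto simp: spd_inverse_def)

lemma spd_psd: "0 \<le> bil k B x x"
  using inv by (auto simp: spd_inverse_def)

lemma spd_right: "a < k \<Longrightarrow> c < k \<Longrightarrow> (\<Sum>b<k. B a b * W b c) = of_bool (a = c)"
  using inv unfolding spd_inverse_def by blast

lemma spd_left: "a < k \<Longrightarrow> c < k \<Longrightarrow> (\<Sum>b<k. W a b * B b c) = of_bool (a = c)"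
proof -
  assume "a < k" "c < k"
  moreover have "(\<Sum>b<k. W a b * B b c) = (\<Sum>b<k. B c b * W b a)"
    by (intro sum.cong refl) (metis spd_sym mult.commute)
  ultimately show ?thesis using spd_right[of c a] by auto
qed

lemma app_inverse: "a < k \<Longrightarrow> app k B (app k W x) a = x a"
proof -
  assume a: "a < k"
  have "app k B (app k W x) a = (\<Sum>c<k. (\<Sum>b<k. B a b * W b c) * x c)"
    unfolding app_def sum_distrib_left sum_distrib_right by (subst sum.swap) (simp add: mult.assoc)
  also have "\<dots> = (\<Sum>c<k. of_bool (a = c) * x c)" using a spd_right by (intro sum.cong) auto
  also have "\<dots> = x a" using a by (simp add: of_bool_def if_distrib[of "\<lambda>x. x * _"] cong: if_cong)
  finally show ?thesis .
qed

lemma bil_inverse: "bil k B y (app k W x) = inner_Rn k y x"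
  unfolding bil_def by (rule inner_cong) (auto simp: app_inverse)

lemma bil_W: "bil k W x x = bil k B (app k W x) (app k W x)"
  unfolding bil_inverse by (simp add: bil_def inner_commute)

lemma bil_W_nonneg: "0 \<le> bil k W x x"
  unfolding bil_W by (rule spd_psd)

lemma W_le_tr: "bil k W x x \<le> tr k W * inner_Rn k x x"
  by (rule bil_le_tr[OF spd_sym(2) bil_W_nonneg])

lemma tr_nonneg: "0 \<le> tr k W"
  unfolding tr_def
proof (rule sum_nonneg)
  fix a assume "a \<in> {..<k}"
  then show "0 \<le> W a a" using bil_W_nonneg[of "\<lambda>i. of_bool (i = a)"] by (simp add: bil_basis)
qed

text \<open>The smallest eigenvalue of \<open>B\<close> is at least the reciprocal of the trace of
  its inverse. Cauchy-Schwarz for the form of \<open>B\<close> is applied to \<open>x\<close> and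
  \<open>app k W x\<close>: the mixed term is the Euclidean square of \<open>x\<close>, and the form
  at \<open>app k W x\<close> is the form of \<open>W\<close> at \<open>x\<close>, which the trace
  controls.\<close>

lemma B_ge_tr: "inner_Rn k x x \<le> tr k W * bil k B x x"
proof -
  have "(inner_Rn k x x)\<^sup>2 \<le> bil k B x x * bil k B (app k W x) (app k W x)"
    using bil_Cauchy_Schwarz[of B k x "app k W x", OF spd_sym(1) spd_psd] by (simp add: bil_inverse)
  also have "\<dots> \<le> bil k B x x * (tr k W * inner_Rn k x x)"
    using W_le_tr[of x] spd_psd[of x] by (intro mult_left_mono) (auto simp: bil_W)
  finally have *: "inner_Rn k x x * inner_Rn k x x \<le> (tr k W * bil k B x x) * inner_Rn k x x"
    by (simp add: power2_eq_square mult_ac)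
  show ?thesis
  proof (cases "inner_Rn k x x = 0")
    case True then show ?thesis using tr_nonneg spd_psd[of x] by simp
  next
    case False
    then have "0 < inner_Rn k x x" using inner_self_nonneg[of k x] by simp
    then show ?thesis using * by (simp add: mult_le_cancel_right)
  qed
qed

text \<open>Cauchy-Schwarz of the diagonal against the all-ones vector; the squares of the other
  entries are then added. In \<open>gram_step\<close> this makes \<open>hs k W\<close> dominate
  \<open>tr k W\<close> when the trace is large compared with \<open>k\<close>.\<close>

lemma hs_ge: "(tr k W)\<^sup>2 \<le> real k * hs k W"
proof -
  have "(\<Sum>a<k. 1 * W a a)\<^sup>2 \<le> (\<Sum>a<k. 1\<^sup>2) * (\<Sum>a<k. (W a a)\<^sup>2)"
    by (rule Cauchy_Schwarz_ineq_sum)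
  also have "\<dots> \<le> (\<Sum>a<k. 1\<^sup>2) * (\<Sum>a<k. \<Sum>b<k. (W a b)\<^sup>2)"
  proof (intro mult_left_mono sum_mono)
    fix a assume "a \<in> {..<k}"
    then show "(W a a)\<^sup>2 \<le> (\<Sum>b<k. (W a b)\<^sup>2)"
      using member_le_sum[of a "{..<k}" "\<lambda>b. (W a b)\<^sup>2"] by simp
  qed (simp add: sum_nonneg)
  also have "\<dots> = real k * hs k W" by (simp add: hs_def)
  finally show ?thesis by (simp add: tr_def)
qed

end

section \<open>Shifts and rank-one updates of an inverse\<close>

context
  fixes k B W assumes inv: "spd_inverse k B W"
begin

lemma app_adjoint: "inner_Rn k (app k W x) y = inner_Rn k x (app k W y)"
  using bil_commute[of W k x y, OF spd_sym(2)[OF inv]] by (simp add: bil_def inner_commute)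

lemma app_left_inverse: "a < k \<Longrightarrow> app k W (app k B x) a = x a"
proof -
  assume a: "a < k"
  have "app k W (app k B x) a = (\<Sum>c<k. (\<Sum>b<k. W a b * B b c) * x c)"
    unfolding app_def sum_distrib_left sum_distrib_right by (subst sum.swap) (simp add: mult.assoc)
  also have "\<dots> = (\<Sum>c<k. of_bool (a = c) * x c)" using a spd_left[OF inv] by (intro sum.cong) auto
  also have "\<dots> = x a" using a by (simp add: of_bool_def if_distrib[of "\<lambda>x. x * _"] cong: if_cong)
  finally show ?thesis .
qed

text \<open>The principal two by two minors of a semidefinite matrix are nonnegative.\<close>

lemma hs_le: "hs k W \<le> (tr k W)\<^sup>2"
proof -
  have "(W a b)\<^sup>2 \<le> W a a * W b b" if "a < k" "b < k" for a b
    using bil_Cauchy_Schwarz[of W k "\<lambda>i. of_bool (i = a)" "\<lambda>i. of_bool (i = b)",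
        OF spd_sym(2)[OF inv] bil_W_nonneg[OF inv]] that
    by (simp add: bil_basis)
  then have "hs k W \<le> (\<Sum>a<k. \<Sum>b<k. W a a * W b b)"
    unfolding hs_def by (intro sum_mono) auto
  also have "\<dots> = (tr k W)\<^sup>2" by (simp add: tr_def power2_eq_square sum_product)
  finally show ?thesis .
qed

text \<open>By \<open>B_ge_tr\<close> the assumption on \<open>d\<close> says that \<open>B\<close>
  is at least \<open>2 d\<close>, so the shifted matrix is still at least \<open>d\<close>. The
  trace bound is a Taylor expansion in \<open>d\<close>: the first-order term is
  \<open>d * hs k W\<close>, and the factor 2 absorbs the remainder.\<close>

lemma spd_shift:
  assumes d: "0 < d" "2 * d * tr k W \<le> 1"
  obtains U where "spd_inverse k (\<lambda>a b. B a b - d * of_bool (a = b)) U"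
    "tr k U \<le> tr k W + 2 * d * hs k W"
proof -
  define B' where "B' a b = B a b - d * of_bool (a = b)" for a b
  have appB': "app k B' x a = app k B x a - d * x a" if "a < k" for x a
    using that by (simp add: app_def B'_def algebra_simps sum_subtractf of_bool_def
        if_distrib[of "(*) _"] cong: if_cong)
  have bilB': "bil k B' x x = bil k B x x - d * inner_Rn k x x" for x
  proof -
    have "bil k B' x x = inner_Rn k x (\<lambda>a. app k B x a - d * x a)"
      unfolding bil_def by (rule inner_cong) (auto simp: appB')
    then show ?thesis by (simp add: inner_linear bil_def)
  qed
  have sym: "B' a b = B' b a" for a b
    using spd_sym(1)[OF inv, of a b] by (auto simp: B'_def)
  have pd: "d * inner_Rn k x x \<le> bil k B' x x" for x
  proof -
    have "2 * d * inner_Rn k x x \<le> 2 * d * (tr k W * bil k B x x)"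
      using B_ge_tr[OF inv] d by (intro mult_left_mono) auto
    also have "\<dots> = (2 * d * tr k W) * bil k B x x" by simp
    also have "\<dots> \<le> 1 * bil k B x x"
      using d spd_psd[OF inv] by (intro mult_right_mono) auto
    finally show ?thesis by (simp add: bilB')
  qed
  obtain U where U: "spd_inverse k B' U" using spd_inverse_exists[OF sym pd d(1)] by blast
  \<comment> \<open>The resolvent identity \<open>U = W + d W U\<close>.\<close>
  have res: "app k U x a = app k W x a + d * app k W (app k U x) a" if "a < k" for x a
  proof -
    define y where "y = app k U x"
    have "app k B y b = x b + d * y b" if "b < k" for b
      using appB'[OF that, of y] app_inverse[OF U that, of x] by (simp add: y_def)
    then have "app k W (app k B y) a = app k W (\<lambda>b. x b + d * y b) a"
      by (simp add: app_def[of k W])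
    then show ?thesis using app_left_inverse[OF that, of y] by (simp add: app_linear y_def)
  qed
  \<comment> \<open>\<open>U\<close> is at most \<open>1 / d\<close> because the shifted matrix is
    at least \<open>d\<close>. For \<open>y = U z\<close> and \<open>t = <y, z>\<close>, the square
    of \<open>t\<close> is at most \<open>|y|^2 |z|^2\<close>, while \<open>d |y|^2\<close> is at
    most \<open>t\<close>; one factor \<open>t\<close> cancels.\<close>
  have Ule: "bil k U z z \<le> inner_Rn k z z / d" for z
  proof -
    define y where "y = app k U z"
    define t where "t = inner_Rn k y z"
    have t: "t = bil k B' y y" "bil k U z z = t"
      using bil_inverse[OF U, of y z] by (simp_all add: y_def t_def bil_def inner_commute)
    have "0 \<le> t" using spd_psd[OF U] t by simp
    have "t\<^sup>2 \<le> inner_Rn k y y * inner_Rn k z z" unfolding t_def by (rule inner_Cauchy_Schwarz)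
    also have "\<dots> \<le> (t / d) * inner_Rn k z z"
      using pd[of y] d t by (intro mult_right_mono inner_self_nonneg) (simp add: field_simps)
    finally have "t * t \<le> (inner_Rn k z z / d) * t" by (simp add: power2_eq_square mult.commute)
    then have "t \<le> inner_Rn k z z / d" if "t \<noteq> 0"
      using that \<open>0 \<le> t\<close> by (intro mult_right_le_imp_le[of t t]) auto
    then show ?thesis using t(2) inner_self_nonneg[of k z] d by (cases "t = 0") auto
  qed
  \<comment> \<open>Using the resolvent identity twice gives
    \<open>U = W + d W W + d^2 W U W\<close>. In the last term one factor \<open>d\<close> cancels
    against the bound \<open>1 / d\<close> on \<open>U\<close>, so that term is at most
    \<open>d W W\<close> as well.\<close>
  have diag: "U a a \<le> W a a + 2 * d * (\<Sum>b<k. (W a b)\<^sup>2)" if a: "a < k" for a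
  proof -
    define e where "e = (\<lambda>i. of_bool (i = a) :: real)"
    define z where "z = app k W e"
    have zz: "inner_Rn k z z = (\<Sum>b<k. (W a b)\<^sup>2)"
      unfolding inner_Rn_def using a spd_sym(2)[OF inv]
      by (intro sum.cong refl) (simp add: z_def e_def app_basis power2_eq_square)
    have UW: "inner_Rn k y (app k U x) = inner_Rn k y (app k W x) + d * inner_Rn k y (app k W (app k U x))"
      for x y
    proof -
      have "inner_Rn k y (app k U x) = inner_Rn k y (\<lambda>a. app k W x a + d * app k W (app k U x) a)"
        by (rule inner_cong) (auto simp: res)
      then show ?thesis by (simp add: inner_linear)
    qed
    have "inner_Rn k e (app k W (app k U e)) = inner_Rn k z (app k U e)"
      by (simp add: z_def app_adjoint)
    also have "\<dots> = inner_Rn k e (app k U z)"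
      using bil_commute[of U k z e, OF spd_sym(2)[OF U]] by (simp add: bil_def)
    also have "\<dots> = inner_Rn k z z + d * inner_Rn k z (app k U z)"
      unfolding UW[of e z] by (simp add: app_adjoint[symmetric] z_def)
    also have "\<dots> \<le> inner_Rn k z z + d * (inner_Rn k z z / d)"
      using Ule[of z] d by (intro add_left_mono mult_left_mono) (auto simp: bil_def)
    finally have "inner_Rn k e (app k W (app k U e)) \<le> 2 * inner_Rn k z z" using d by simp
    then have "d * inner_Rn k e (app k W (app k U e)) \<le> d * (2 * inner_Rn k z z)"
      using d by (intro mult_left_mono) auto
    then show ?thesis
      using UW[of e e] a bil_basis[OF a a, of U] bil_basis[OF a a, of W]
      by (simp add: e_def[symmetric] bil_def zz)
  qed
  have "tr k U \<le> (\<Sum>a<k. W a a + 2 * d * (\<Sum>b<k. (W a b)\<^sup>2))"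
    unfolding tr_def by (intro sum_mono diag) auto
  also have "\<dots> = tr k W + 2 * d * hs k W"
    by (simp add: tr_def hs_def sum.distrib sum_distrib_left)
  finally show ?thesis using that[of U] U by (simp add: B'_def[abs_def])
qed

text \<open>The Sherman-Morrison formula. Expanding the square, the change of \<open>hs\<close> is
  \<open>-2/s <z, W z> + |z|^4 / s^2\<close>. As \<open>|z|^2\<close> is the form of
  \<open>W\<close> at the pair \<open>z\<close>, \<open>v\<close>, Cauchy-Schwarz and
  \<open>s = 1 + <v, W v>\<close> show that this change is not positive.\<close>

lemma spd_rank_one:
  fixes v
  defines "z \<equiv> app k W v" and "s \<equiv> 1 + bil k W v v"
  defines "W' \<equiv> (\<lambda>a b. W a b - z a * z b / s)"
  shows "spd_inverse k (\<lambda>a b. B a b + v a * v b) W'"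
    "tr k W' = tr k W - inner_Rn k z z / s" "hs k W' \<le> hs k W"
proof -
  have s: "1 \<le> s" using bil_W_nonneg[OF inv] by (simp add: s_def)
  have vz: "inner_Rn k v z = s - 1" by (simp add: s_def z_def bil_def)
  show "spd_inverse k (\<lambda>a b. B a b + v a * v b) W'"
    unfolding spd_inverse_def
  proof (intro conjI allI impI)
    fix a c assume ac: "a < k" "c < k"
    have 1: "(\<Sum>b<k. B a b * z b) = v a"
      using app_inverse[OF inv ac(1), of v] by (simp add: z_def app_def[of k B])
    have 2: "(\<Sum>b<k. v b * W b c) = z c"
      unfolding z_def app_def by (intro sum.cong refl) (metis mult.commute spd_sym(2)[OF inv])
    have 3: "(\<Sum>b<k. v b * z b) = s - 1" using vz by (simp add: inner_Rn_def)
    have "(\<Sum>b<k. (B a b + v a * v b) * W' b c) =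
       (\<Sum>b<k. B a b * W b c) - (\<Sum>b<k. B a b * z b) * (z c / s)
        + v a * (\<Sum>b<k. v b * W b c) - v a * (\<Sum>b<k. v b * z b) * (z c / s)"
      unfolding W'_def sum_distrib_left sum_distrib_right sum_subtractf[symmetric] sum.distrib[symmetric]
      by (intro sum.cong refl) (simp add: algebra_simps)
    also have "\<dots> = of_bool (a = c)"
      unfolding 1 2 3 spd_right[OF inv ac] using s by (simp add: field_simps)
    finally show "(\<Sum>b<k. (B a b + v a * v b) * W' b c) = of_bool (a = c)" .
  next
    fix x
    have "bil k (\<lambda>a b. B a b + v a * v b) x x = bil k B x x + (inner_Rn k v x)\<^sup>2"
      by (simp add: bil_sum inner_Rn_def power2_eq_square sum_product algebra_simps sum.distrib)
    then show "0 \<le> bil k (\<lambda>a b. B a b + v a * v b) x x" using spd_psd[OF inv, of x] by simp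
  next
    show "W' a b = W' b a" for a b by (simp add: W'_def mult.commute spd_sym(2)[OF inv, of a b])
  next
    show "B a b + v a * v b = B b a + v b * v a" for a b
      by (simp add: mult.commute spd_sym(1)[OF inv, of a b])
  qed
  show "tr k W' = tr k W - inner_Rn k z z / s"
    by (simp add: tr_def W'_def sum_subtractf inner_Rn_def sum_divide_distrib)
  have "hs k W' = (\<Sum>a<k. \<Sum>b<k. (W a b)\<^sup>2 - 2 / s * (z a * W a b * z b) + 1 / s\<^sup>2 * ((z a * z a) * (z b * z b)))"
    unfolding hs_def W'_def using s
    by (intro sum.cong refl) (simp add: field_simps power2_eq_square)
  also have "\<dots> = hs k W - 2 / s * bil k W z z + 1 / s\<^sup>2 * (\<Sum>a<k. \<Sum>b<k. (z a * z a) * (z b * z b))"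
    by (simp add: hs_def bil_sum sum.distrib sum_subtractf sum_distrib_left)
  also have "(\<Sum>a<k. \<Sum>b<k. (z a * z a) * (z b * z b)) = (inner_Rn k z z)\<^sup>2"
    by (simp add: inner_Rn_def power2_eq_square sum_product)
  finally have "hs k W' = hs k W - 2 / s * bil k W z z + (inner_Rn k z z)\<^sup>2 / s\<^sup>2" by simp
  moreover have "(inner_Rn k z z)\<^sup>2 / s\<^sup>2 \<le> 2 / s * bil k W z z"
  proof -
    have "(inner_Rn k z z)\<^sup>2 = (bil k W z v)\<^sup>2" by (simp add: bil_def z_def)
    also have "\<dots> \<le> bil k W z z * bil k W v v"
      by (rule bil_Cauchy_Schwarz[OF spd_sym(2)[OF inv] bil_W_nonneg[OF inv]])
    also have "\<dots> \<le> bil k W z z * (2 * s)"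
      using bil_W_nonneg[OF inv] s by (intro mult_left_mono) (auto simp: s_def)
    finally have "(inner_Rn k z z)\<^sup>2 / s\<^sup>2 \<le> bil k W z z * (2 * s) / s\<^sup>2"
      by (intro divide_right_mono) auto
    then show ?thesis using s by (simp add: power2_eq_square mult_ac)
  qed
  ultimately show "hs k W' \<le> hs k W" by simp
qed

end

section \<open>Selecting a well-conditioned part of a tight frame\<close>

text \<open>The frame operator of a subfamily, shifted down by a barrier \<open>l\<close>; the trace
  of its inverse is the potential of the barrier argument.\<close>

definition gram :: "'i set \<Rightarrow> ('i \<Rightarrow> nat \<Rightarrow> real) \<Rightarrow> real \<Rightarrow> nat \<Rightarrow> nat \<Rightarrow> real" where
  "gram S v l a b = (\<Sum>i\<in>S. v i a * v i b) - l * of_bool (a = b)"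

lemma gram_sym: "gram S v l a b = gram S v l b a"
  by (auto simp: gram_def mult.commute intro: sum.cong)

lemma bil_gram: "bil k (gram S v l) x x = (\<Sum>i\<in>S. (inner_Rn k (v i) x)\<^sup>2) - l * inner_Rn k x x"
proof -
  have "bil k (gram S v l) x x =
      (\<Sum>a<k. \<Sum>b<k. \<Sum>i\<in>S. (v i a * x a) * (v i b * x b)) - l * (\<Sum>a<k. \<Sum>b<k. of_bool (a = b) * (x a * x b))"
    unfolding bil_sum gram_def sum_distrib_left sum_subtractf[symmetric]
    by (intro sum.cong refl) (simp add: algebra_simps sum_distrib_left sum_distrib_right)
  also have "(\<Sum>a<k. \<Sum>b<k. of_bool (a = b) * (x a * x b)) = inner_Rn k x x"
    unfolding inner_Rn_def
    by (intro sum.cong refl) (simp add: of_bool_def if_distrib[of "\<lambda>x. x * _"] cong: if_cong)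
  also have "(\<Sum>a<k. \<Sum>b<k. \<Sum>i\<in>S. (v i a * x a) * (v i b * x b)) =
     (\<Sum>i\<in>S. \<Sum>a<k. \<Sum>b<k. (v i a * x a) * (v i b * x b))"
    by (subst (2) sum.swap, subst sum.swap) simp
  also have "\<dots> = (\<Sum>i\<in>S. (inner_Rn k (v i) x)\<^sup>2)"
    by (simp add: inner_Rn_def power2_eq_square sum_product)
  finally show ?thesis .
qed

section \<open>The barrier argument\<close>

context
  fixes k N :: nat and I :: "'i set" and v :: "'i \<Rightarrow> nat \<Rightarrow> real"
  assumes fin: "finite I" and N: "N = card I" and k: "0 < k" "128 * k \<le> N"
    and tight: "\<And>a b. a < k \<Longrightarrow> b < k \<Longrightarrow> (\<Sum>i\<in>I. v i a * v i b) = of_bool (a = b)"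
begin

lemma frame_identity: "(\<Sum>i\<in>I. (inner_Rn k (v i) x)\<^sup>2) = inner_Rn k x x"
proof -
  have "bil k (gram I v 1) x x = 0" unfolding bil_sum using tight by (simp add: gram_def)
  then show ?thesis by (simp add: bil_gram)
qed

text \<open>Exchanges a sum over frame vectors for a sum over columns of \<open>W\<close>, where
  either the tight frame identity or \<open>bil_gram\<close> can evaluate the inner sum.\<close>

lemma sum_app_squares:
  assumes "\<And>a b. W a b = W b a"
  shows "(\<Sum>i\<in>S. inner_Rn k (app k W (v i)) (app k W (v i))) =
    (\<Sum>c<k. \<Sum>i\<in>S. (inner_Rn k (v i) (app k W (\<lambda>j. of_bool (j = c))))\<^sup>2)"
proof -
  have "app k W (v i) c = inner_Rn k (v i) (app k W (\<lambda>j. of_bool (j = c)))" if "c < k" for i c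
    using that bil_commute[of W k "\<lambda>j. of_bool (j = c)" "v i", OF assms] by (simp add: bil_def inner_basis)
  then show ?thesis
    by (subst sum.swap) (simp add: inner_Rn_def[of k "app k W _"] power2_eq_square)
qed

text \<open>One step of the barrier argument: the barrier \<open>l\<close> moves up by a fixed amount while the potential
  \<open>tr (A - l)\<^sup>-\<^sup>1\<close> stays below \<open>N / 16\<close>. If the potential is below \<open>4 k\<close> no vector has to be added; otherwise
  averaging over the unused vectors gives one whose rank-one update pays for the move.\<close>

lemma gram_step:
  assumes \<tau>: "\<tau> \<subseteq> I" and W: "spd_inverse k (gram \<tau> v l) W" "tr k W \<le> real N / 16" and l: "l \<le> 1/4"
  obtains \<tau>' W' where "\<tau>' \<subseteq> I" "card \<tau>' \<le> card \<tau> + 1"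
    "spd_inverse k (gram \<tau>' v (l + 1 / (8 * real N))) W'" "tr k W' \<le> real N / 16"
proof -
  define d where "d = 1 / (8 * real N)"
  have N0: "0 < real N" using k by linarith
  have k': "128 * real k \<le> real N" using k(2) by linarith
  have d: "0 < d" using N0 by (simp add: d_def)
  \<comment> \<open>At the maximal potential \<open>N / 16\<close> the left side is 1/64. The bound
    thus permits the shift by \<open>d\<close>, and also makes the second-order cost at most the
    potential itself.\<close>
  have dtr: "2 * d * t \<le> 1" if "t \<le> real N / 16" for t
  proof -
    have "2 * d * t \<le> 2 * d * (real N / 16)" using d that by (intro mult_left_mono) auto
    also have "\<dots> \<le> 1" using N0 by (simp add: d_def)
    finally show ?thesis .
  qed
  have tr0: "0 \<le> tr k W" by (rule tr_nonneg[OF W(1)])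
  have gram_d: "(\<lambda>a b. gram S v l a b - d * of_bool (a = b)) = gram S v (l + d)" for S
    by (auto simp: gram_def fun_eq_iff algebra_simps)
  show ?thesis
  proof (cases "tr k W < 4 * real k")
    case True
    obtain U where U: "spd_inverse k (gram \<tau> v (l + d)) U" "tr k U \<le> tr k W + 2 * d * hs k W"
      using spd_shift[OF W(1) d dtr[OF W(2)]] unfolding gram_d by blast
    \<comment> \<open>A potential below \<open>4 k\<close> at most doubles under the shift, and
      \<open>8 k\<close> is at most \<open>N / 16\<close>.\<close>
    have "2 * d * hs k W \<le> 2 * d * (tr k W)\<^sup>2"
      using hs_le[OF W(1)] d by (intro mult_left_mono) auto
    also have "\<dots> = (2 * d * tr k W) * tr k W" by (simp add: power2_eq_square)
    also have "\<dots> \<le> 1 * tr k W" using dtr[OF W(2)] tr0 by (intro mult_right_mono)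
    finally have "tr k U \<le> real N / 16" using U(2) True k' by linarith
    then show ?thesis using that[OF \<tau> _ U(1)[unfolded d_def]] by simp
  next
    case False
    then have tr4: "4 * real k \<le> tr k W" by simp
    define q where "q i = inner_Rn k (app k W (v i)) (app k W (v i))" for i
    have hsW: "hs k W = (\<Sum>c<k. inner_Rn k (app k W (\<lambda>j. of_bool (j = c))) (app k W (\<lambda>j. of_bool (j = c))))"
      unfolding hs_def inner_Rn_def
      by (intro sum.cong refl) (simp add: app_basis power2_eq_square spd_sym(2)[OF W(1)])
    have sumI: "(\<Sum>i\<in>I. q i) = hs k W"
      unfolding q_def sum_app_squares[of W, OF spd_sym(2)[OF W(1)]] frame_identity hsW ..
    \<comment> \<open>With \<open>B\<close> the shifted frame operator of \<tau>, the sum is the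
      trace of \<open>W (B + l) W\<close>, and \<open>W B W = W\<close>.\<close>
    have sumT: "(\<Sum>i\<in>\<tau>. q i) = tr k W + l * hs k W"
    proof -
      have "(\<Sum>i\<in>\<tau>. (inner_Rn k (v i) (app k W (\<lambda>j. of_bool (j = c))))\<^sup>2) =
          W c c + l * inner_Rn k (app k W (\<lambda>j. of_bool (j = c))) (app k W (\<lambda>j. of_bool (j = c)))"
        if "c < k" for c
        using bil_W[OF W(1), of "\<lambda>j. of_bool (j = c)"] that by (simp add: bil_gram bil_basis)
      then show ?thesis
        unfolding q_def sum_app_squares[of W, OF spd_sym(2)[OF W(1)]] hsW tr_def
        by (simp add: sum.distrib sum_distrib_left)
    qed
    have sumB: "(\<Sum>i\<in>I. bil k W (v i) (v i)) = tr k W"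
    proof -
      have "(\<Sum>i\<in>I. bil k W (v i) (v i)) = (\<Sum>a<k. \<Sum>b<k. \<Sum>i\<in>I. v i a * W a b * v i b)"
        unfolding bil_sum by (subst sum.swap, subst (2) sum.swap) simp
      also have "\<dots> = (\<Sum>a<k. \<Sum>b<k. W a b * (\<Sum>i\<in>I. v i a * v i b))"
        by (simp add: sum_distrib_left mult_ac)
      also have "\<dots> = (\<Sum>a<k. \<Sum>b<k. W a b * of_bool (a = b))"
        using tight by (intro sum.cong refl) auto
      also have "\<dots> = tr k W"
        unfolding tr_def
        by (intro sum.cong refl) (simp add: of_bool_def if_distrib[of "(*) _"] cong: if_cong)
      finally show ?thesis .
    qed
    have hs4: "4 * tr k W \<le> hs k W"
    proof -
      have "real k * (4 * tr k W) \<le> (tr k W)\<^sup>2"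
        using mult_right_mono[OF tr4 tr0] by (simp add: power2_eq_square mult_ac)
      also have "\<dots> \<le> real k * hs k W" by (rule hs_ge[OF W(1)])
      finally show ?thesis using k(1) by simp
    qed
    have hs0: "0 < hs k W" using hs4 tr4 k(1) by simp
    have "\<exists>i\<in>I - \<tau>. 2 * d * hs k W * (1 + bil k W (v i) (v i)) \<le> q i"
    proof (rule ccontr)
      assume "\<not> ?thesis"
      then have less: "q i \<le> 2 * d * hs k W * (1 + bil k W (v i) (v i))" if "i \<in> I - \<tau>" for i
        using that by force
      have "hs k W - (tr k W + l * hs k W) = (\<Sum>i\<in>I - \<tau>. q i)"
        using sum_diff[OF fin \<tau>, of q] sumI sumT by simp
      also have "\<dots> \<le> (\<Sum>i\<in>I - \<tau>. 2 * d * hs k W * (1 + bil k W (v i) (v i)))"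
        by (intro sum_mono less)
      also have "\<dots> \<le> (\<Sum>i\<in>I. 2 * d * hs k W * (1 + bil k W (v i) (v i)))"
      proof (rule sum_mono2[OF fin])
        fix i
        show "0 \<le> 2 * d * hs k W * (1 + bil k W (v i) (v i))"
          using d hs0 bil_W_nonneg[OF W(1), of "v i"] by (intro mult_nonneg_nonneg) auto
      qed auto
      also have "\<dots> = 2 * d * hs k W * (real N + tr k W)"
        by (simp add: sum_distrib_left[symmetric] sum.distrib sumB N)
      also have "\<dots> \<le> 2 * d * hs k W * (real N + real N / 16)"
        using d hs0 W(2) by (intro mult_left_mono) auto
      also have "\<dots> = 17 / 64 * hs k W" using N0 by (simp add: d_def field_simps)
      finally have "hs k W - (tr k W + l * hs k W) \<le> 17 / 64 * hs k W" .
      moreover have "l * hs k W \<le> 1/4 * hs k W" using l hs0 by (intro mult_right_mono) auto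
      ultimately show False using hs4 hs0 by linarith
    qed
    then obtain i where i: "i \<in> I" "i \<notin> \<tau>" "2 * d * hs k W * (1 + bil k W (v i) (v i)) \<le> q i"
      by blast
    define s where "s = 1 + bil k W (v i) (v i)"
    have s: "1 \<le> s" using bil_W_nonneg[OF W(1)] by (simp add: s_def)
    obtain W1 where W1: "spd_inverse k (\<lambda>a b. gram \<tau> v l a b + v i a * v i b) W1"
        "tr k W1 = tr k W - q i / s" "hs k W1 \<le> hs k W"
      using spd_rank_one[OF W(1), of "v i"] unfolding q_def s_def by blast
    have "(\<lambda>a b. gram \<tau> v l a b + v i a * v i b) = gram (insert i \<tau>) v l"
      using i(2) finite_subset[OF \<tau> fin] by (auto simp: gram_def fun_eq_iff)
    then have W1': "spd_inverse k (gram (insert i \<tau>) v l) W1" using W1(1) by simp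
    \<comment> \<open>The rank-one update lowers the trace by \<open>q i / s\<close>, which covers
      the cost \<open>2 * d * hs k W1\<close> of the next shift because \<open>hs\<close> has not
      increased.\<close>
    have "2 * d * hs k W \<le> q i / s" using i(3) s by (simp add: s_def[symmetric] pos_le_divide_eq)
    then have tr1: "tr k W1 \<le> tr k W - 2 * d * hs k W" using W1(2) by simp
    moreover have "0 \<le> 2 * d * hs k W" using d hs0 by simp
    ultimately have tr1': "tr k W1 \<le> real N / 16" using W(2) by linarith
    obtain U where U: "spd_inverse k (gram (insert i \<tau>) v (l + d)) U" "tr k U \<le> tr k W1 + 2 * d * hs k W1"
      using spd_shift[OF W1' d dtr[OF tr1']] unfolding gram_d by blast
    have "2 * d * hs k W1 \<le> 2 * d * hs k W" using W1(3) d by (intro mult_left_mono) auto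
    then have "tr k U \<le> real N / 16" using U(2) tr1 W(2) by linarith
    moreover have "card (insert i \<tau>) \<le> card \<tau> + 1"
      using i(2) finite_subset[OF \<tau> fin] by simp
    ultimately show ?thesis using that[of "insert i \<tau>" U] U(1) \<tau> i(1) by (simp add: d_def)
  qed
qed

text \<open>The barrier starts at \<open>-16 k / N\<close>: with no vector selected the matrix is
  \<open>16 k / N\<close> times the identity, whose inverse has trace exactly \<open>N / 16\<close>.
  The bound on \<open>m\<close> keeps the barrier at most 1/4 before each step.\<close>

lemma gram_iterate:
  assumes "real m \<le> 2 * real N"
  shows "\<exists>\<tau> W. \<tau> \<subseteq> I \<and> card \<tau> \<le> m \<and>
    spd_inverse k (gram \<tau> v (real m / (8 * real N) - 16 * real k / real N)) W \<and> tr k W \<le> real N / 16"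
  using assms
proof (induction m)
  case 0
  define L where "L = 16 * real k / real N"
  have N0: "0 < real N" using k by linarith
  have L: "0 < L" using k N0 by (simp add: L_def)
  have g: "gram {} v (- L) = (\<lambda>a b. L * of_bool (a = b))" by (simp add: gram_def fun_eq_iff)
  have "(\<Sum>b<k. L * of_bool (a = b) * (of_bool (b = c) / L)) = of_bool (a = c)" if "a < k" for a c
  proof -
    have "(\<Sum>b<k. L * of_bool (a = b) * (of_bool (b = c) / L)) = (\<Sum>b<k. if b = a then of_bool (a = c) else 0)"
      using L by (intro sum.cong refl) auto
    then show ?thesis using that by simp
  qed
  moreover have "0 \<le> bil k (gram {} v (- L)) x x" for x
    using L inner_self_nonneg[of k x] unfolding bil_gram by simp
  ultimately have "spd_inverse k (gram {} v (- L)) (\<lambda>a b. of_bool (a = b) / L)"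
    unfolding spd_inverse_def by (auto simp: g)
  moreover have "tr k (\<lambda>a b. of_bool (a = b) / L) = real N / 16"
    using k N0 by (simp add: tr_def L_def)
  ultimately show ?case by (intro exI[of _ "{}"] exI[of _ "\<lambda>a b. of_bool (a = b) / L"]) (simp add: L_def)
next
  case (Suc m)
  have N0: "0 < real N" using k by linarith
  have m: "real m \<le> 2 * real N" using Suc.prems by simp
  obtain \<tau> W where 1: "\<tau> \<subseteq> I" "card \<tau> \<le> m"
      "spd_inverse k (gram \<tau> v (real m / (8 * real N) - 16 * real k / real N)) W" "tr k W \<le> real N / 16"
    using Suc.IH[OF m] by blast
  have "real m / (8 * real N) \<le> 1/4" using m N0 by (simp add: field_simps)
  moreover have "0 \<le> 16 * real k / real N" by simp
  ultimately have "real m / (8 * real N) - 16 * real k / real N \<le> 1/4" by linarith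
  then obtain \<tau>' W' where 2: "\<tau>' \<subseteq> I" "card \<tau>' \<le> card \<tau> + 1"
      "spd_inverse k (gram \<tau>' v (real m / (8 * real N) - 16 * real k / real N + 1 / (8 * real N))) W'"
      "tr k W' \<le> real N / 16"
    using gram_step[OF 1(1,3,4)] by blast
  have "real m / (8 * real N) - 16 * real k / real N + 1 / (8 * real N)
      = real (Suc m) / (8 * real N) - 16 * real k / real N"
    by (simp add: add_divide_distrib)
  then have "spd_inverse k (gram \<tau>' v (real (Suc m) / (8 * real N) - 16 * real k / real N)) W'"
    using 2(3) by (simp only:)
  then show ?case using 2(1,2,4) 1(2) by (intro exI[of _ \<tau>'] exI[of _ W']) auto
qed

end

lemma tight_frame_subset:
  fixes v :: "'i \<Rightarrow> nat \<Rightarrow> real"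
  assumes fin: "finite I"
    and tight: "\<And>a b. a < k \<Longrightarrow> b < k \<Longrightarrow> (\<Sum>i\<in>I. v i a * v i b) = of_bool (a = b)"
    and \<theta>: "0 < \<theta>" "\<theta> \<le> 1" and k: "1024 * real k \<le> \<theta> * real (card I)"
  obtains \<tau> where "\<tau> \<subseteq> I" "real (card \<tau>) \<le> \<theta> * real (card I)"
    "\<And>x. \<theta> / 16 * inner_Rn k x x \<le> (\<Sum>i\<in>\<tau>. (inner_Rn k (v i) x)\<^sup>2)"
proof (cases "k = 0")
  case True
  then show ?thesis using that[of "{}"] \<theta> by (simp add: inner_Rn_def)
next
  case False
  define N where "N = card I"
  have "\<theta> * real N \<le> 1 * real N" using \<theta> by (intro mult_right_mono) auto
  then have kN: "1024 * real k \<le> real N" using k by (simp add: N_def)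
  have k1: "1 \<le> real k" using False by simp
  have N0: "0 < real N" using kN k1 by linarith
  define m where "m = nat \<lfloor>\<theta> * real N\<rfloor>"
  have m: "real m \<le> \<theta> * real N" "\<theta> * real N - 1 \<le> real m"
    using \<theta> by (simp_all add: m_def)
  have "128 * k \<le> N" using kN by linarith
  moreover have "real m \<le> 2 * real N" using m(1) \<open>\<theta> * real N \<le> 1 * real N\<close> by simp
  ultimately obtain \<tau> W where \<tau>: "\<tau> \<subseteq> I" "card \<tau> \<le> m"
      "spd_inverse k (gram \<tau> v (real m / (8 * real N) - 16 * real k / real N)) W"
    using gram_iterate[of I N k v m, OF fin N_def _ _ tight] False by blast
  define l where "l = real m / (8 * real N) - 16 * real k / real N"
  \<comment> \<open>Rounding down \<open>\<theta> N\<close> loses at most 1, hence at most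
    \<open>k\<close>; the total loss of \<open>129 k\<close> is below half of
    \<open>\<theta> N\<close> because \<open>1024 k\<close> is at most \<open>\<theta> N\<close>.
    Division by \<open>8 N\<close> then leaves \<open>\<theta> / 16\<close>.\<close>
  have "(real m - 128 * real k) \<ge> \<theta> * real N / 2"
    using m(2) k k1 by (simp add: N_def)
  then have l: "\<theta> / 16 \<le> l" using N0 by (simp add: l_def field_simps)
  show ?thesis
  proof (rule that[OF \<tau>(1)])
    show "real (card \<tau>) \<le> \<theta> * real (card I)" using \<tau>(2) m(1) by (simp add: N_def)
    fix x
    have "\<theta> / 16 * inner_Rn k x x \<le> l * inner_Rn k x x"
      using l inner_self_nonneg by (intro mult_right_mono)
    also have "\<dots> \<le> (\<Sum>i\<in>\<tau>. (inner_Rn k (v i) x)\<^sup>2)"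
      using spd_psd[OF \<tau>(3), of x] by (simp add: bil_gram l_def)
    finally show "\<theta> / 16 * inner_Rn k x x \<le> (\<Sum>i\<in>\<tau>. (inner_Rn k (v i) x)\<^sup>2)" .
  qed
qed

section \<open>The norm of a symmetric convex body\<close>

lemma norm_Rn_nonneg: "0 \<le> norm_Rn n x"
  by (simp add: norm_Rn_def inner_self_nonneg)

lemma norm_Rn_sq: "(norm_Rn n x)\<^sup>2 = inner_Rn n x x"
  by (simp add: norm_Rn_def inner_self_nonneg)

lemma norm_Rn_scale: "norm_Rn n (\<lambda>i. c * x i) = \<bar>c\<bar> * norm_Rn n x"
  by (simp add: norm_Rn_def inner_linear real_sqrt_mult mult.assoc[symmetric])

lemma abs_coord_le_norm_Rn: "i < n \<Longrightarrow> \<bar>x i\<bar> \<le> norm_Rn n x"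
proof -
  assume "i < n"
  then have "x i * x i \<le> (\<Sum>i<n. x i * x i)"
    by (intro member_le_sum[where f = "\<lambda>i. x i * x i"]) auto
  then have "sqrt ((x i)\<^sup>2) \<le> norm_Rn n x"
    unfolding norm_Rn_def inner_Rn_def by (intro real_sqrt_le_mono) (simp add: power2_eq_square)
  then show ?thesis by simp
qed

lemma continuous_on_coord: "continuous_on S (\<lambda>x. x i :: real)"
  by (rule continuous_on_subset[OF continuous_on_product_coordinates]) simp

lemma continuous_on_inner_Rn: "continuous_on S (\<lambda>x. inner_Rn n x y)"
  unfolding inner_Rn_def by (intro continuous_on_real_sqrt continuous_on_sum continuous_on_mult
      continuous_on_diff continuous_on_const continuous_on_coord)

lemma continuous_on_norm_Rn: "continuous_on S (norm_Rn n)"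
  unfolding norm_Rn_def[abs_def] inner_Rn_def by (intro continuous_on_real_sqrt continuous_on_sum continuous_on_mult
      continuous_on_diff continuous_on_const continuous_on_coord)

lemma Rn_iff: "x \<in> Rn n \<longleftrightarrow> (\<forall>i\<ge>n. x i = 0)"
  by (simp add: topspace_Euclidean_space)

lemma Rn_closed_ops:
  "x \<in> Rn n \<Longrightarrow> y \<in> Rn n \<Longrightarrow> (\<lambda>i. x i + y i) \<in> Rn n"
  "x \<in> Rn n \<Longrightarrow> y \<in> Rn n \<Longrightarrow> (\<lambda>i. x i - y i) \<in> Rn n"
  "x \<in> Rn n \<Longrightarrow> (\<lambda>i. c * x i) \<in> Rn n"
  "(\<And>j. j \<in> J \<Longrightarrow> f j \<in> Rn n) \<Longrightarrow> (\<lambda>i. \<Sum>j\<in>J. a j * f j i) \<in> Rn n"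
  by (auto simp: Rn_iff)

text \<open>Two-sided comparison with the Euclidean norm takes the place of definiteness; it also
  yields continuity and boundedness on the sphere.\<close>

definition norm_on :: "nat \<Rightarrow> ((nat \<Rightarrow> real) \<Rightarrow> real) \<Rightarrow> bool" where
  "norm_on n N \<longleftrightarrow> (\<forall>x\<in>Rn n. \<forall>c. N (\<lambda>i. c * x i) = \<bar>c\<bar> * N x) \<and>
     (\<forall>x\<in>Rn n. \<forall>y\<in>Rn n. N (\<lambda>i. x i + y i) \<le> N x + N y) \<and>
     (\<exists>\<alpha> \<beta>. 0 < \<alpha> \<and> 0 < \<beta> \<and> (\<forall>x\<in>Rn n. \<alpha> * norm_Rn n x \<le> N x \<and> N x \<le> \<beta> * norm_Rn n x))"

context
  fixes n K assumes K: "symmetric_convex_body n K"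
begin

lemma body_compact: "compact K" and body_subset: "K \<subseteq> Rn n"
proof -
  have "compactin (Euclidean_space n) K" using K by (simp add: symmetric_convex_body_def)
  then have "compactin euclidean K \<and> K \<subseteq> {x. \<forall>i\<ge>n. x i = 0}"
    unfolding Euclidean_space_def euclidean_product_topology compactin_subtopology .
  then show "compact K" "K \<subseteq> Rn n" by (auto simp: Rn_iff)
qed

lemma body_convex:
  "x \<in> K \<Longrightarrow> y \<in> K \<Longrightarrow> 0 \<le> t \<Longrightarrow> t \<le> 1 \<Longrightarrow> (\<lambda>i. (1 - t) * x i + t * y i) \<in> K"
  using K by (simp add: symmetric_convex_body_def)

lemma body_symmetric: "x \<in> K \<Longrightarrow> (\<lambda>i. - x i) \<in> K"
  using K by (simp add: symmetric_convex_body_def)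

lemma body_contains_ball:
  "\<exists>r>0. \<forall>x\<in>Rn n. norm_Rn n x \<le> r \<longrightarrow> x \<in> K"
proof -
  obtain p where p: "p \<in> Euclidean_space n interior_of K"
    using K by (auto simp: symmetric_convex_body_def)
  define U where "U = Euclidean_space n interior_of K"
  have U: "openin (Euclidean_space n) U" "p \<in> U" "U \<subseteq> K"
    using p interior_of_subset[of "Euclidean_space n" K] by (simp_all add: U_def)
  obtain T where T: "openin (powertop_real UNIV) T" "U = T \<inter> {x. \<forall>i\<ge>n. x i = 0}"
    using U(1) unfolding Euclidean_space_def openin_subtopology by blast
  obtain X where X: "p \<in> (\<Pi>\<^sub>E i\<in>UNIV. X i)" "\<And>i. openin euclideanreal (X i)"
      "(\<Pi>\<^sub>E i\<in>UNIV. X i) \<subseteq> T"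
    using product_topology_open_contains_basis[OF T(1), of p] U(2) T(2) by blast
  have pX: "p i \<in> X i" for i using X(1) by auto
  have "\<exists>d>0. \<forall>y. \<bar>y - p i\<bar> < d \<longrightarrow> y \<in> X i" for i
    using X(2)[of i] pX[of i] unfolding open_openin[symmetric] open_dist by (auto simp: dist_real_def)
  then obtain d where d: "\<And>i. 0 < d i" "\<And>i y. \<bar>y - p i\<bar> < d i \<Longrightarrow> y \<in> X i" by metis
  \<comment> \<open>Only the \<open>n\<close> first coordinates of the box restrict
    \<open>x\<close>, so a finite minimum is enough. The inserted 1 keeps the set nonempty for
    \<open>n = 0\<close>, and halving makes \<open>r\<close> strictly smaller than each
    \<open>d i\<close>.\<close>
  define r where "r = Min (insert 1 (d ` {..<n})) / 2"
  have r0: "0 < r" unfolding r_def using d(1) by (simp add: Min_gr_iff)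
  have rd: "r < d i" if "i < n" for i
  proof -
    have "Min (insert 1 (d ` {..<n})) \<le> d i" using that by (intro Min_le) auto
    moreover have "2 * r = Min (insert 1 (d ` {..<n}))" by (simp add: r_def)
    ultimately show ?thesis using r0 by linarith
  qed
  have p0: "p i = 0" if "n \<le> i" for i using U(2) T(2) that by auto
  have shift: "(\<lambda>i. p i + x i) \<in> K" if x: "x \<in> Rn n" "norm_Rn n x \<le> r" for x
  proof -
    have "p i + x i \<in> X i" for i
    proof (cases "i < n")
      case True
      have "\<bar>x i\<bar> < d i" using abs_coord_le_norm_Rn[OF True, of x] x(2) rd[OF True] by linarith
      then show ?thesis by (intro d(2)) simp
    next
      case False
      then show ?thesis using x(1) pX[of i] by (simp add: Rn_iff)
    qed
    then have "(\<lambda>i. p i + x i) \<in> T" using X(3) by auto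
    moreover have "\<forall>i\<ge>n. p i + x i = 0" using p0 x(1) by (simp add: Rn_iff)
    ultimately show ?thesis using U(3) T(2) by blast
  qed
  show ?thesis
  proof (intro exI[of _ r] conjI ballI impI r0)
    fix x assume x: "x \<in> Rn n" "norm_Rn n x \<le> r"
    have "(\<lambda>i. -1 * x i) \<in> Rn n" "norm_Rn n (\<lambda>i. -1 * x i) \<le> r"
      using x by (simp_all only: Rn_closed_ops norm_Rn_scale abs_minus abs_one mult_1)
    then have "(\<lambda>i. - (p i + -1 * x i)) \<in> K" using shift body_symmetric by blast
    \<comment> \<open>By symmetry \<open>x - p\<close> lies in \<open>K\<close>, and
      \<open>x\<close> is the midpoint of \<open>p + x\<close> and \<open>x - p\<close>.\<close>
    then have "(\<lambda>i. (1 - 1/2) * (p i + x i) + 1/2 * - (p i + -1 * x i)) \<in> K"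
      by (intro body_convex shift x) auto
    then show "x \<in> K" by (simp add: add_divide_distrib diff_divide_distrib)
  qed
qed

lemma zero_in_body: "(\<lambda>i. 0) \<in> K"
proof -
  obtain r where "0 < r" "\<And>x. x \<in> Rn n \<Longrightarrow> norm_Rn n x \<le> r \<Longrightarrow> x \<in> K"
    using body_contains_ball by blast
  then show ?thesis by (simp add: Rn_iff norm_Rn_def inner_Rn_def)
qed

lemma body_scale: "x \<in> K \<Longrightarrow> 0 \<le> t \<Longrightarrow> t \<le> 1 \<Longrightarrow> (\<lambda>i. t * x i) \<in> K"
  using body_convex[OF zero_in_body, of x t] by simp

lemma body_norm_le: "0 < t \<Longrightarrow> (\<lambda>i. x i / t) \<in> K \<Longrightarrow> body_norm K x \<le> t"
  unfolding body_norm_def by (rule cInf_lower) (auto intro: bdd_belowI[of _ 0])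

text \<open>The ball inside \<open>K\<close> makes the set of admissible dilations nonempty. Some
  admissible \<open>u\<close> lies below \<open>t\<close>, and \<open>K\<close> is star-shaped about
  the origin.\<close>

lemma body_norm_absorb:
  assumes x: "x \<in> Rn n" and t: "body_norm K x < t"
  shows "0 < t" "(\<lambda>i. x i / t) \<in> K"
proof -
  obtain r where r: "0 < r" "\<And>x. x \<in> Rn n \<Longrightarrow> norm_Rn n x \<le> r \<Longrightarrow> x \<in> K"
    using body_contains_ball by blast
  define s where "s = norm_Rn n x / r + 1"
  have s: "0 < s" using r(1) norm_Rn_nonneg[of n x] by (simp add: s_def add_nonneg_pos)
  have "norm_Rn n (\<lambda>i. (1 / s) * x i) \<le> r"
    using s r(1) by (simp only: norm_Rn_scale) (simp add: field_simps s_def)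
  then have "(\<lambda>i. x i / s) \<in> K" using r(2) Rn_closed_ops(3)[OF x, of "1 / s"] by simp
  then have ne: "{t. 0 < t \<and> (\<lambda>i. x i / t) \<in> K} \<noteq> {}" using s by blast
  obtain u where u: "0 < u" "(\<lambda>i. x i / u) \<in> K" "u < t"
    using cInf_lessD[OF ne] t unfolding body_norm_def by blast
  then show "0 < t" by simp
  have "(\<lambda>i. (u / t) * (x i / u)) \<in> K" using u by (intro body_scale) auto
  then show "(\<lambda>i. x i / t) \<in> K" using u by simp
qed

text \<open>Every \<open>t x\<close> with \<open>0 < t < 1\<close> lies in \<open>K\<close>, and
  \<open>K\<close> is closed, so \<open>x\<close> itself is reached as the limit.\<close>

lemma body_norm_le_1: "x \<in> Rn n \<Longrightarrow> body_norm K x \<le> 1 \<Longrightarrow> x \<in> K"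
proof -
  assume x: "x \<in> Rn n" "body_norm K x \<le> 1"
  have "continuous_on UNIV (\<lambda>t i. t * x i)"
    by (intro continuous_on_coordinatewise_then_product continuous_intros)
  then have "closed ((\<lambda>t i. t * x i) -` K)"
    using compact_imp_closed[OF body_compact] by (simp add: closed_vimage)
  moreover have "{0<..<1} \<subseteq> (\<lambda>t i. t * x i) -` K"
  proof
    fix t :: real assume t: "t \<in> {0<..<1}"
    then have "1 < 1 / t" by simp
    then have "(\<lambda>i. x i / (1 / t)) \<in> K" using x(2) by (intro body_norm_absorb(2)[OF x(1)]) linarith
    then show "t \<in> (\<lambda>t i. t * x i) -` K" by (simp add: mult.commute)
  qed
  ultimately have "closure {0<..<1} \<subseteq> (\<lambda>t i. t * x i) -` K" by (intro closure_minimal)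
  then have "1 \<in> (\<lambda>t i. t * x i) -` K" by (rule subsetD) simp
  then show "x \<in> K" by simp
qed

lemma body_norm_scale_pos_le: "x \<in> Rn n \<Longrightarrow> 0 < c \<Longrightarrow> body_norm K (\<lambda>i. c * x i) \<le> c * body_norm K x"
proof -
  assume x: "x \<in> Rn n" and c: "0 < c"
  have "body_norm K (\<lambda>i. c * x i) / c \<le> body_norm K x"
  proof (rule dense_ge)
    fix t assume t: "body_norm K x < t"
    have "body_norm K (\<lambda>i. c * x i) \<le> c * t"
      using body_norm_absorb[OF x t] c by (intro body_norm_le) auto
    then show "body_norm K (\<lambda>i. c * x i) / c \<le> t" using c by (simp add: field_simps)
  qed
  then show ?thesis using c by (simp add: field_simps)
qed

lemma body_norm_scale_pos: "x \<in> Rn n \<Longrightarrow> 0 < c \<Longrightarrow> body_norm K (\<lambda>i. c * x i) = c * body_norm K x"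
proof -
  assume x: "x \<in> Rn n" and c: "0 < c"
  have "body_norm K (\<lambda>i. 1 / c * (c * x i)) \<le> 1 / c * body_norm K (\<lambda>i. c * x i)"
    using c by (intro body_norm_scale_pos_le Rn_closed_ops(3) x) auto
  moreover have "(\<lambda>i. 1 / c * (c * x i)) = x" using c by auto
  ultimately have "body_norm K x \<le> 1 / c * body_norm K (\<lambda>i. c * x i)" by (simp only:)
  then have "c * body_norm K x \<le> body_norm K (\<lambda>i. c * x i)" using c by (simp add: pos_le_divide_eq mult.commute)
  then show ?thesis using body_norm_scale_pos_le[OF x c] by linarith
qed

lemma body_norm_minus: "x \<in> Rn n \<Longrightarrow> body_norm K (\<lambda>i. - x i) = body_norm K x"
proof -
  have *: "(\<lambda>i. - x i) \<in> K \<longleftrightarrow> x \<in> K" for x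
    using body_symmetric[of x] body_symmetric[of "\<lambda>i. - x i"] by auto
  have "(\<lambda>i. - x i / t) \<in> K \<longleftrightarrow> (\<lambda>i. x i / t) \<in> K" for t
    using *[of "\<lambda>i. x i / t"] by simp
  then show ?thesis unfolding body_norm_def by simp
qed

lemma norm_on_body_norm: "norm_on n (body_norm K)"
  unfolding norm_on_def
proof (intro conjI ballI allI)
  obtain r where r: "0 < r" "\<And>x. x \<in> Rn n \<Longrightarrow> norm_Rn n x \<le> r \<Longrightarrow> x \<in> K"
    using body_contains_ball by blast
  have nn: "0 \<le> body_norm K x" if "x \<in> Rn n" for x
    using body_norm_absorb(1)[OF that, of 0] by force
  have le: "body_norm K x \<le> 1 / r * norm_Rn n x" if x: "x \<in> Rn n" for x
  proof (rule dense_ge)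
    fix t assume t: "1 / r * norm_Rn n x < t"
    have "0 \<le> 1 / r * norm_Rn n x" using r(1) norm_Rn_nonneg[of n x] by simp
    then have t0: "0 < t" using t by linarith
    have "norm_Rn n (\<lambda>i. (1 / t) * x i) \<le> r"
      using t t0 r(1) by (simp only: norm_Rn_scale) (simp add: field_simps)
    then have "(\<lambda>i. x i / t) \<in> K" using r(2) Rn_closed_ops(3)[OF x, of "1 / t"] by simp
    then show "body_norm K x \<le> t" using t0 by (intro body_norm_le)
  qed
  show "body_norm K (\<lambda>i. c * x i) = \<bar>c\<bar> * body_norm K x" if x: "x \<in> Rn n" for x c
  proof (cases c "0 :: real" rule: linorder_cases)
    case less
    then show ?thesis
      using body_norm_minus[OF Rn_closed_ops(3)[OF x, of "- c"]] body_norm_scale_pos[OF x, of "- c"] by simp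
  next
    case equal
    have "body_norm K (\<lambda>i. 0) = 0"
      using le[of "\<lambda>i. 0"] nn[of "\<lambda>i. 0"] by (simp add: Rn_iff norm_Rn_def inner_Rn_def)
    then show ?thesis using equal by simp
  next
    case greater
    then show ?thesis using body_norm_scale_pos[OF x] by simp
  qed
  show "body_norm K (\<lambda>i. x i + y i) \<le> body_norm K x + body_norm K y"
    if x: "x \<in> Rn n" and y: "y \<in> Rn n" for x y
  proof (rule field_le_epsilon)
    fix e :: real assume e: "0 < e"
    define s where "s = body_norm K x + e / 2"
    define t where "t = body_norm K y + e / 2"
    have s: "0 < s" "(\<lambda>i. x i / s) \<in> K" using body_norm_absorb[OF x, of s] e by (auto simp: s_def)
    have t: "0 < t" "(\<lambda>i. y i / t) \<in> K" using body_norm_absorb[OF y, of t] e by (auto simp: t_def)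
    \<comment> \<open>The weights \<open>s / (s + t)\<close> and \<open>t / (s + t)\<close> cancel
      the denominators of \<open>x / s\<close> and \<open>y / t\<close>.\<close>
    have "(\<lambda>i. (1 - t / (s + t)) * (x i / s) + t / (s + t) * (y i / t)) \<in> K"
      using s t by (intro body_convex) auto
    moreover have "(1 - t / (s + t)) * (x i / s) + t / (s + t) * (y i / t) = (x i + y i) / (s + t)" for i
    proof -
      have "1 - t / (s + t) = s / (s + t)" using s(1) t(1) by (simp add: field_simps)
      then show ?thesis using s(1) t(1) by (simp add: add_divide_distrib)
    qed
    ultimately have "(\<lambda>i. (x i + y i) / (s + t)) \<in> K" by (simp only:)
    then have "body_norm K (\<lambda>i. x i + y i) \<le> s + t"
      using add_pos_pos[OF s(1) t(1)] by (rule body_norm_le[rotated])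
    then show "body_norm K (\<lambda>i. x i + y i) \<le> body_norm K x + body_norm K y + e"
      by (simp add: s_def t_def)
  qed
  have "compact (norm_Rn n ` K)"
    by (rule compact_continuous_image[OF continuous_on_norm_Rn body_compact])
  then obtain B where B: "\<And>x. x \<in> K \<Longrightarrow> norm_Rn n x \<le> B"
    using compact_imp_bounded[of "norm_Rn n ` K"] abs_le_D1 unfolding bounded_real by blast
  define b where "b = max B 1"
  have b: "0 < b" "\<And>x. x \<in> K \<Longrightarrow> norm_Rn n x \<le> b"
    using B by (auto simp: b_def le_max_iff_disj)
  have ge: "1 / b * norm_Rn n x \<le> body_norm K x" if x: "x \<in> Rn n" for x
  proof (rule dense_ge)
    fix t assume "body_norm K x < t"
    then have t: "0 < t" "(\<lambda>i. x i / t) \<in> K" using body_norm_absorb[OF x] by auto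
    then have "norm_Rn n (\<lambda>i. (1 / t) * x i) \<le> b" using b(2) by simp
    then have "norm_Rn n x / t \<le> b" using t(1) by (simp only: norm_Rn_scale) simp
    then show "1 / b * norm_Rn n x \<le> t" using t(1) b(1) by (simp add: field_simps)
  qed
  have "1 / b * norm_Rn n x \<le> body_norm K x \<and> body_norm K x \<le> 1 / r * norm_Rn n x" if "x \<in> Rn n" for x
    using ge[OF that] le[OF that] by simp
  then have "\<forall>x\<in>Rn n. 1 / b * norm_Rn n x \<le> body_norm K x \<and> body_norm K x \<le> 1 / r * norm_Rn n x"
    by (rule ballI)
  moreover have "0 < 1 / b" "0 < 1 / r" using r(1) b(1) by simp_all
  ultimately show "\<exists>\<alpha> \<beta>. 0 < \<alpha> \<and> 0 < \<beta> \<and>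
      (\<forall>x\<in>Rn n. \<alpha> * norm_Rn n x \<le> body_norm K x \<and> body_norm K x \<le> \<beta> * norm_Rn n x)"
    by (intro exI conjI)
qed

end

section \<open>Norms comparable to the Euclidean norm\<close>

context
  fixes n N assumes N: "norm_on n N"
begin

lemma norm_on_scale: "x \<in> Rn n \<Longrightarrow> N (\<lambda>i. c * x i) = \<bar>c\<bar> * N x"
  using N by (simp add: norm_on_def)

lemma norm_on_triangle: "x \<in> Rn n \<Longrightarrow> y \<in> Rn n \<Longrightarrow> N (\<lambda>i. x i + y i) \<le> N x + N y"
  using N by (simp add: norm_on_def)

lemma norm_on_bounds:
  "\<exists>\<alpha> \<beta>. 0 < \<alpha> \<and> 0 < \<beta> \<and> (\<forall>x\<in>Rn n. \<alpha> * norm_Rn n x \<le> N x \<and> N x \<le> \<beta> * norm_Rn n x)"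
  using N unfolding norm_on_def by blast

lemma norm_on_nonneg: "x \<in> Rn n \<Longrightarrow> 0 \<le> N x"
proof -
  assume x: "x \<in> Rn n"
  obtain \<alpha> \<beta> where ab: "0 < \<alpha>" "\<forall>x\<in>Rn n. \<alpha> * norm_Rn n x \<le> N x \<and> N x \<le> \<beta> * norm_Rn n x"
    using norm_on_bounds by blast
  have "0 \<le> \<alpha> * norm_Rn n x" using ab(1) norm_Rn_nonneg[of n x] by simp
  then show ?thesis using bspec[OF ab(2) x] by linarith
qed

lemma norm_on_sum:
  assumes "finite J" "\<And>j. j \<in> J \<Longrightarrow> f j \<in> Rn n"
  shows "N (\<lambda>i. \<Sum>j\<in>J. f j i) \<le> (\<Sum>j\<in>J. N (f j))"
  using assms
proof (induction J rule: finite_induct)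
  case empty
  have "N (\<lambda>i. 0 * 0) = \<bar>0\<bar> * N (\<lambda>i. 0)" by (rule norm_on_scale) (simp add: Rn_iff)
  then show ?case by simp
next
  case (insert a J)
  have "(\<lambda>i. \<Sum>j\<in>J. f j i) \<in> Rn n" using Rn_closed_ops(4)[of J f n "\<lambda>_. 1"] insert.prems by simp
  then have "N (\<lambda>i. f a i + (\<Sum>j\<in>J. f j i)) \<le> N (f a) + N (\<lambda>i. \<Sum>j\<in>J. f j i)"
    using insert.prems by (intro norm_on_triangle) auto
  then show ?case using insert by simp
qed

lemma continuous_on_norm_on: "continuous_on (Rn n) N"
proof -
  obtain \<alpha> \<beta> where \<beta>: "0 < \<beta>" "\<forall>x\<in>Rn n. \<alpha> * norm_Rn n x \<le> N x \<and> N x \<le> \<beta> * norm_Rn n x"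
    using norm_on_bounds by blast
  have d: "\<bar>N x - N y\<bar> \<le> \<beta> * norm_Rn n (\<lambda>i. x i - y i)" if x: "x \<in> Rn n" and y: "y \<in> Rn n" for x y
  proof -
    have 1: "N x \<le> N y + N (\<lambda>i. x i - y i)"
      using norm_on_triangle[OF y Rn_closed_ops(2)[OF x y]] by simp
    have 2: "N y \<le> N x + N (\<lambda>i. y i - x i)"
      using norm_on_triangle[OF x Rn_closed_ops(2)[OF y x]] by simp
    have 3: "N (\<lambda>i. y i - x i) = N (\<lambda>i. x i - y i)"
      using norm_on_scale[OF Rn_closed_ops(2)[OF x y], of "-1"] by simp
    show ?thesis using 1 2 3 bspec[OF \<beta>(2) Rn_closed_ops(2)[OF x y]] by linarith
  qed
  show ?thesis
    unfolding continuous_on_def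
  proof
    fix x assume x: "x \<in> Rn n"
    have "continuous_on (Rn n) (\<lambda>y. \<beta> * norm_Rn n (\<lambda>i. y i - x i))"
      unfolding norm_Rn_def inner_Rn_def by (intro continuous_on_real_sqrt continuous_on_sum continuous_on_mult
      continuous_on_diff continuous_on_const continuous_on_coord)
    then have "((\<lambda>y. \<beta> * norm_Rn n (\<lambda>i. y i - x i)) \<longlongrightarrow> \<beta> * norm_Rn n (\<lambda>i. x i - x i)) (at x within Rn n)"
      using x unfolding continuous_on_def by blast
    then have lim: "((\<lambda>y. \<beta> * norm_Rn n (\<lambda>i. y i - x i)) \<longlongrightarrow> 0) (at x within Rn n)"
      by (simp add: norm_Rn_def inner_Rn_def)
    have "((\<lambda>y. N y - N x) \<longlongrightarrow> 0) (at x within Rn n)"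
      by (rule Lim_null_comparison[OF _ lim]) (use d x in \<open>auto simp: eventually_at_filter\<close>)
    then show "(N \<longlongrightarrow> N x) (at x within Rn n)" by (simp add: LIM_zero_iff)
  qed
qed

end

section \<open>Orthonormal systems\<close>

text \<open>Indexed from 0, unlike the basis \<open>e\<close>, and without a spanning condition;
  spanning for \<open>m = n\<close> is derived in \<open>orthonormal_expansion\<close>.\<close>

definition orthonormal_system :: "nat \<Rightarrow> nat \<Rightarrow> (nat \<Rightarrow> nat \<Rightarrow> real) \<Rightarrow> bool" where
  "orthonormal_system n m x \<longleftrightarrow> (\<forall>j<m. x j \<in> Rn n) \<and>
     (\<forall>j<m. \<forall>l<m. inner_Rn n (x j) (x l) = of_bool (j = l))"

lemma inner_sum_left: "inner_Rn n (\<lambda>i. \<Sum>j\<in>J. c j * x j i) y = (\<Sum>j\<in>J. c j * inner_Rn n (x j) y)"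
  unfolding inner_Rn_def sum_distrib_left sum_distrib_right
  by (subst sum.swap) (simp add: mult.assoc)

lemma inner_system_left:
  assumes "orthonormal_system n m x" "l < m"
  shows "inner_Rn n (\<lambda>i. \<Sum>j<m. c j * x j i) (x l) = c l"
proof -
  have "inner_Rn n (\<lambda>i. \<Sum>j<m. c j * x j i) (x l) = (\<Sum>j<m. if j = l then c j else 0)"
    unfolding inner_sum_left
    by (intro sum.cong refl) (use assms in \<open>auto simp: orthonormal_system_def\<close>)
  then show ?thesis using assms(2) by simp
qed

lemma inner_system:
  assumes "orthonormal_system n m x"
  shows "inner_Rn n (\<lambda>i. \<Sum>j<m. c j * x j i) (\<lambda>i. \<Sum>j<m. d j * x j i) = inner_Rn m c d"
proof -
  have "inner_Rn n (\<lambda>i. \<Sum>j<m. c j * x j i) (\<lambda>i. \<Sum>j<m. d j * x j i)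
      = (\<Sum>l<m. d l * inner_Rn n (x l) (\<lambda>i. \<Sum>j<m. c j * x j i))"
    by (subst inner_commute) (rule inner_sum_left)
  also have "\<dots> = inner_Rn m c d"
    unfolding inner_Rn_def[of m]
    by (intro sum.cong refl) (simp add: inner_commute[of n "x _"] inner_system_left[OF assms])
  finally show ?thesis .
qed

text \<open>For a square matrix a left inverse is a right inverse. Orthonormality of the rows
  \<open>x j\<close> says that \<open>C\<close>, the transpose, has the row matrix as left inverse.
  So the right inverse \<open>W\<close> of \<open>C\<close> is the row matrix, and the columns are
  orthonormal too.\<close>

lemma orthonormal_expansion:
  assumes x: "orthonormal_system n n x" and w: "w \<in> Rn n"
  shows "(\<lambda>i. \<Sum>j<n. inner_Rn n w (x j) * x j i) = w"
proof -
  have xx: "(\<Sum>b<n. x a b * x c b) = of_bool (a = c)" if "a < n" "c < n" for a c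
    using x that by (auto simp: orthonormal_system_def inner_Rn_def)
  define C where "C i j = x j i" for i j
  have inj: "\<forall>a<n. c a = 0" if c: "\<forall>a<n. app n C c a = 0" for c
  proof (intro allI impI)
    fix a assume a: "a < n"
    have "c a = inner_Rn n (\<lambda>i. \<Sum>j<n. c j * x j i) (x a)" using inner_system_left[OF x a] by simp
    also have "\<dots> = 0"
      using c unfolding inner_Rn_def app_def C_def by (intro sum.neutral) (auto simp: mult.commute)
    finally show "c a = 0" .
  qed
  obtain W where "\<forall>a<n. \<forall>c<n. (\<Sum>b<n. C a b * W b c) = of_bool (a = c) \<and>
      (\<Sum>b<n. W a b * C b c) = of_bool (a = c)"
    using right_inverse_exists[of n C, OF inj] by blast
  then have W: "\<And>a c. a < n \<Longrightarrow> c < n \<Longrightarrow> (\<Sum>b<n. C a b * W b c) = of_bool (a = c)" by blast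
  have WX: "W a c = x a c" if a: "a < n" "c < n" for a c
  proof -
    have "(\<Sum>l<n. \<Sum>b<n. x a l * C l b * W b c) = (\<Sum>l<n. x a l * of_bool (l = c))"
      by (intro sum.cong refl) (use W[OF _ a(2)] in \<open>simp add: sum_distrib_left[symmetric] mult.assoc\<close>)
    also have "\<dots> = x a c" using a by (simp add: of_bool_def if_distrib[of "(*) _"] cong: if_cong)
    finally have 1: "(\<Sum>l<n. \<Sum>b<n. x a l * C l b * W b c) = x a c" .
    have "(\<Sum>l<n. \<Sum>b<n. x a l * C l b * W b c) = (\<Sum>b<n. (\<Sum>l<n. x a l * C l b) * W b c)"
      by (subst sum.swap) (simp add: sum_distrib_right)
    also have "\<dots> = (\<Sum>b<n. of_bool (a = b) * W b c)"
      using xx[OF a(1)] by (intro sum.cong refl) (simp add: C_def)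
    also have "\<dots> = W a c" using a by (simp add: of_bool_def if_distrib[of "\<lambda>x. x * _"] cong: if_cong)
    finally show ?thesis using 1 by simp
  qed
  have XX: "(\<Sum>j<n. x j i * x j l) = of_bool (i = l)" if "i < n" "l < n" for i l
    using W[OF that] WX that by (simp add: C_def)
  show ?thesis
  proof
    fix i show "(\<Sum>j<n. inner_Rn n w (x j) * x j i) = w i"
    proof (cases "i < n")
      case True
      have "(\<Sum>j<n. inner_Rn n w (x j) * x j i) = (\<Sum>l<n. w l * (\<Sum>j<n. x j i * x j l))"
        unfolding inner_Rn_def sum_distrib_left sum_distrib_right
        by (subst sum.swap) (simp add: mult_ac)
      also have "\<dots> = (\<Sum>l<n. w l * of_bool (i = l))" using XX[OF True] by simp
      also have "\<dots> = w i" using True by (simp add: of_bool_def if_distrib[of "(*) _"] cong: if_cong)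
      finally show ?thesis .
    next
      case False
      then have "x j i = 0" if "j < n" for j using x that by (auto simp: orthonormal_system_def Rn_iff)
      then show ?thesis using w False by (simp add: Rn_iff)
    qed
  qed
qed

lemma orthonormal_system_insert:
  assumes x: "orthonormal_system n m x" and zR: "z \<in> Rn n" and zz: "inner_Rn n z z = 1"
    and xz: "\<And>j. j < m \<Longrightarrow> inner_Rn n z (x j) = 0"
  shows "orthonormal_system n (Suc m) (x(m := z))"
  unfolding orthonormal_system_def
proof (intro conjI allI impI)
  fix j assume j: "j < Suc m"
  show "(x(m := z)) j \<in> Rn n"
    using x zR j by (cases "j = m") (simp_all add: orthonormal_system_def)
  fix l assume l: "l < Suc m"
  consider "j = m" "l = m" | "j = m" "l < m" | "j < m" "l = m" | "j < m" "l < m"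
    using j l by linarith
  then show "inner_Rn n ((x(m := z)) j) ((x(m := z)) l) = of_bool (j = l)"
  proof cases
    case 2
    then show ?thesis using xz[of l] by simp
  next
    case 4
    then show ?thesis using x by (simp add: orthonormal_system_def)
  next
    case 1
    then show ?thesis using zz by simp
  next
    case 3
    then show ?thesis using xz[of j] inner_commute[of n z "x j"] by simp
  qed
qed

lemma orthonormal_system_step:
  assumes x: "orthonormal_system n m x" and m: "m < n"
  shows "\<exists>x'. orthonormal_system n (Suc m) x' \<and> (\<forall>j<m. x' j = x j)"
proof -
  \<comment> \<open>Padding the \<open>m\<close> rows by zero rows gives a singular square matrix,
    because row \<open>m\<close> is zero. A kernel vector is orthogonal to all \<open>x j\<close>
    with \<open>j < m\<close>.\<close>
  define B where "B a b = (if a < m then x a b else 0)" for a b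
  have "\<not> (\<forall>y. (\<forall>a<n. app n B y a = 0) \<longrightarrow> (\<forall>a<n. y a = 0))"
  proof
    assume "\<forall>y. (\<forall>a<n. app n B y a = 0) \<longrightarrow> (\<forall>a<n. y a = 0)"
    then obtain W where "\<forall>a<n. \<forall>c<n. (\<Sum>b<n. B a b * W b c) = of_bool (a = c) \<and>
        (\<Sum>b<n. W a b * B b c) = of_bool (a = c)"
      using right_inverse_exists[of n B] by blast
    then have "(\<Sum>b<n. B m b * W b m) = 1" using m by simp
    then show False by (simp add: B_def)
  qed
  then obtain y where y: "\<And>a. a < n \<Longrightarrow> app n B y a = 0" "\<not> (\<forall>a<n. y a = 0)" by blast
  define s where "s = norm_Rn n y"
  have y0: "inner_Rn n y y \<noteq> 0" using y(2) inner_self_eq_0 by blast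
  then have s: "0 < s" using inner_self_nonneg[of n y] by (simp add: s_def norm_Rn_def)
  define z where "z i = (if i < n then 1 / s * y i else 0)" for i
  have zy: "inner_Rn n u z = 1 / s * inner_Rn n u y" for u
    unfolding inner_linear(6)[symmetric] by (rule inner_cong) (auto simp: z_def)
  have zz: "inner_Rn n z z = 1"
  proof -
    have "inner_Rn n z z = 1 / s * (1 / s * inner_Rn n y y)"
      using zy[of z] zy[of y] by (simp add: inner_commute)
    then show ?thesis using y0 s norm_Rn_sq[of n y] by (simp add: s_def power2_eq_square)
  qed
  have xz: "inner_Rn n (x j) z = 0" if "j < m" for j
    using y(1)[of j] that m zy[of "x j"] by (simp add: app_def B_def inner_Rn_def)
  have zR: "z \<in> Rn n" by (simp add: z_def Rn_iff)
  have "orthonormal_system n (Suc m) (x(m := z))"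
    by (rule orthonormal_system_insert[OF x zR zz]) (simp add: xz inner_commute[of n z])
  then show ?thesis by (intro exI[of _ "x(m := z)"]) auto
qed

lemma orthonormal_system_extend:
  assumes "orthonormal_system n m x" "m \<le> n"
  shows "\<exists>x'. orthonormal_system n n x' \<and> (\<forall>j<m. x' j = x j)"
  using assms
proof (induction "n - m" arbitrary: m x)
  case 0 then show ?case by auto
next
  case (Suc d)
  then have m: "m < n" "d = n - Suc m" "Suc m \<le> n" by auto
  obtain x1 where x1: "orthonormal_system n (Suc m) x1" "\<forall>j<m. x1 j = x j"
    using orthonormal_system_step[OF Suc.prems(1) m(1)] by blast
  obtain x2 where x2: "orthonormal_system n n x2" "\<forall>j<Suc m. x2 j = x1 j"
    using Suc.hyps(1)[OF m(2) x1(1) m(3)] by blast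
  have "x2 j = x j" if "j < m" for j
    using x2(2)[rule_format, of j] x1(2)[rule_format, of j] that by simp
  then show ?case using x2(1) by blast
qed

text \<open>Otherwise the first \<open>n\<close> members already span, and the member with index
  \<open>n\<close>, being orthogonal to them, would vanish although it has length 1.\<close>

lemma orthonormal_system_le: "orthonormal_system n m x \<Longrightarrow> m \<le> n"
proof (rule ccontr)
  assume x: "orthonormal_system n m x" and "\<not> m \<le> n"
  then have m: "n < m" by simp
  then have xn: "orthonormal_system n n x" using x by (simp add: orthonormal_system_def)
  have "x n \<in> Rn n" "\<And>j. j < n \<Longrightarrow> inner_Rn n (x n) (x j) = 0" "inner_Rn n (x n) (x n) = 1"
    using x m by (simp_all add: orthonormal_system_def)
  moreover have "inner_Rn n (x n) (x n) = 0"
    using orthonormal_expansion[OF xn \<open>x n \<in> Rn n\<close>] calculation(2) by (simp add: inner_Rn_def fun_eq_iff)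
  ultimately show False by simp
qed

section \<open>Averaging over rotations\<close>

lemma finite_signs: "finite ({..<m :: nat} \<rightarrow>\<^sub>E {-1, 1 :: real})"
  by (intro finite_PiE) auto

lemma card_signs: "card ({..<m :: nat} \<rightarrow>\<^sub>E {-1, 1 :: real}) = 2 ^ m"
  by (simp add: card_PiE numeral_2_eq_2)

lemma sign_square:
  assumes "\<epsilon> \<in> {..<m :: nat} \<rightarrow>\<^sub>E {-1, 1 :: real}" "j < m"
  shows "\<epsilon> j * \<epsilon> j = 1"
  using PiE_mem[OF assms(1), of j] assms(2) by auto

text \<open>Multiplying each sign by the sign of \<open>c j\<close> permutes the sign vectors. The
  hypothesis on \<open>g\<close> removes the influence of indices from \<open>m\<close> on, where
  sign vectors are \<open>undefined\<close>.\<close>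

lemma sum_signs_abs:
  fixes g :: "(nat \<Rightarrow> real) \<Rightarrow> real"
  assumes g: "\<And>c d. (\<And>j. j < m \<Longrightarrow> c j = d j) \<Longrightarrow> g c = g d"
  shows "(\<Sum>\<epsilon>\<in>{..<m} \<rightarrow>\<^sub>E {-1, 1}. g (\<lambda>j. \<epsilon> j * c j)) = (\<Sum>\<epsilon>\<in>{..<m} \<rightarrow>\<^sub>E {-1, 1}. g (\<lambda>j. \<epsilon> j * \<bar>c j\<bar>))"
proof -
  define s where "s j = (if c j < 0 then -1 else 1 :: real)" for j
  define F where "F \<epsilon> = restrict (\<lambda>j. \<epsilon> j * s j) {..<m}" for \<epsilon> :: "nat \<Rightarrow> real"
  have FE: "F \<epsilon> \<in> {..<m} \<rightarrow>\<^sub>E {-1, 1}" if "\<epsilon> \<in> {..<m} \<rightarrow>\<^sub>E {-1, 1}" for \<epsilon>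
  proof (rule PiE_I)
    fix j assume "j \<in> {..<m}"
    then have "\<epsilon> j = -1 \<or> \<epsilon> j = 1" using that by (auto simp: PiE_iff)
    then show "F \<epsilon> j \<in> {-1, 1}" using \<open>j \<in> {..<m}\<close> by (auto simp: F_def s_def)
  qed (simp add: F_def)
  have FF: "F (F \<epsilon>) = \<epsilon>" if "\<epsilon> \<in> {..<m} \<rightarrow>\<^sub>E {-1, 1}" for \<epsilon>
    using that by (auto simp: F_def s_def fun_eq_iff PiE_iff extensional_def)
  show ?thesis
  proof (rule sum.reindex_bij_witness[of _ F F])
    fix \<epsilon> :: "nat \<Rightarrow> real"
    show "g (\<lambda>j. F \<epsilon> j * \<bar>c j\<bar>) = g (\<lambda>j. \<epsilon> j * c j)"
      by (rule g) (simp add: F_def s_def abs_if)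
  qed (use FE FF in auto)
qed

lemma bij_shift_mod: "bij_betw (\<lambda>j. (j + s) mod n) {..<n} {..<n :: nat}"
proof -
  have "inj_on (\<lambda>j. (j + s) mod n) {..<n}"
  proof (rule inj_onI)
    fix a b assume "a \<in> {..<n}" "b \<in> {..<n}" and "(a + s) mod n = (b + s) mod n"
    then show "a = b"
    proof (induction a b rule: linorder_wlog)
      case (le a b)
      then have "n dvd (b + s) - (a + s)" using mod_eq_dvd_iff_nat[of "a + s" "b + s" n] by simp
      then have "n dvd b - a" by simp
      then have "b - a = 0" using le(3) by (metis dvd_imp_le lessThan_iff less_imp_diff_less linorder_not_less neq0_conv)
      then show ?case using le(1) by simp
    next
      case (sym a b)
      then show ?case by simp
    qed
  qed
  moreover have "(\<lambda>j. (j + s) mod n) ` {..<n} \<subseteq> {..<n}" by auto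
  ultimately show ?thesis by (simp add: bij_betw_def endo_inj_surj)
qed

text \<open>A lower bound for \<open>|t|\<close> by even moments, tight at \<open>|t| = s\<close>; it replaces the first absolute moment
  of a coordinate by its second and fourth ones.\<close>

lemma abs_ge_quartic: "0 < s \<Longrightarrow> 3/2 * (t\<^sup>2 / s) - 1/2 * (t^4 / s^3) \<le> \<bar>t :: real\<bar>"
proof -
  assume s: "0 < s"
  define u where "u = \<bar>t\<bar> / s"
  have u: "0 \<le> u" "\<bar>t\<bar> = s * u" using s by (auto simp: u_def)
  have t2: "t\<^sup>2 = (s * u)\<^sup>2" "t^4 = (s * u)^4"
    using u(2) by (metis power2_abs, metis power_even_abs_numeral even_numeral)
  \<comment> \<open>In the rescaled variable the difference of the two sides has a double root at 1,
    which makes the factorization nonnegative.\<close>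
  have "0 \<le> u * ((u - 1)\<^sup>2 * (u + 2)) / 2" using u(1) by simp
  also have "u * ((u - 1)\<^sup>2 * (u + 2)) / 2 = u - (3/2 * u\<^sup>2 - 1/2 * u^4)"
    by (simp add: power2_eq_square power4_eq_xxxx field_simps)
  finally have "s * (3/2 * u\<^sup>2 - 1/2 * u^4) \<le> s * u" using s by (intro mult_left_mono) auto
  then show ?thesis unfolding t2 u(2) using s
    by (simp add: power_mult_distrib power2_eq_square power3_eq_cube power4_eq_xxxx algebra_simps)
qed

section \<open>Coordinates of a random point of the sphere\<close>

context
  fixes n :: nat and \<mu> :: "(nat \<Rightarrow> real) measure" and x :: "nat \<Rightarrow> nat \<Rightarrow> real"
  assumes \<mu>: "rotation_invariant_prob n \<mu>" and x: "orthonormal_system n n x" and n: "1 \<le> n"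
begin

definition coord :: "(nat \<Rightarrow> real) \<Rightarrow> nat \<Rightarrow> real" where "coord w j = inner_Rn n w (x j)"

definition recon :: "(nat \<Rightarrow> real) \<Rightarrow> nat \<Rightarrow> real" where "recon c = (\<lambda>i. \<Sum>j<n. c j * x j i)"

lemma prob_mu: "prob_space \<mu>" using \<mu> by (simp add: rotation_invariant_prob_def)

lemma sets_mu: "sets \<mu> = sets (restrict_space borel (unit_sphere n))"
  using \<mu> by (simp add: rotation_invariant_prob_def)

lemma space_mu: "space \<mu> = unit_sphere n"
  using sets_eq_imp_space_eq[OF sets_mu] by (simp add: space_restrict_space)

lemma recon_Rn: "recon c \<in> Rn n"
  unfolding recon_def by (rule Rn_closed_ops(4)) (use x in \<open>auto simp: orthonormal_system_def\<close>)

lemma coord_recon: "j < n \<Longrightarrow> coord (recon c) j = c j"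
  unfolding coord_def recon_def by (rule inner_system_left[OF x])

lemma recon_coord: "w \<in> Rn n \<Longrightarrow> recon (coord w) = w"
  unfolding coord_def recon_def by (rule orthonormal_expansion[OF x])

lemma inner_recon: "inner_Rn n (recon c) (recon d) = inner_Rn n c d"
  unfolding recon_def by (rule inner_system[OF x])

lemma inner_coord: "w \<in> Rn n \<Longrightarrow> v \<in> Rn n \<Longrightarrow> inner_Rn n (coord w) (coord v) = inner_Rn n w v"
  by (metis inner_recon recon_coord)

lemma sphere_Rn: "w \<in> unit_sphere n \<Longrightarrow> w \<in> Rn n"
  by (simp add: unit_sphere_def)

lemma sphere_coord: "w \<in> unit_sphere n \<Longrightarrow> (\<Sum>j<n. (coord w j)\<^sup>2) = 1"
  using inner_coord[of w w] norm_Rn_sq[of n w]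
  by (simp add: unit_sphere_def inner_Rn_def[of n "coord w"] power2_eq_square)

lemma measurable_mu: "f \<in> borel_measurable (restrict_space borel (unit_sphere n)) \<Longrightarrow> f \<in> borel_measurable \<mu>"
  using measurable_cong_sets[OF sets_mu refl] by blast

lemma measurable_coord: "(\<lambda>w. coord w j) \<in> borel_measurable borel"
  unfolding coord_def by (rule borel_measurable_continuous_onI[OF continuous_on_inner_Rn])

lemma measurable_coord_mu [measurable]: "(\<lambda>w. coord w j) \<in> borel_measurable \<mu>"
  by (intro measurable_mu measurable_restrict_space1 measurable_coord)

lemma measurable_norm_on: "norm_on n N \<Longrightarrow> N \<in> borel_measurable \<mu>"
  by (intro measurable_mu borel_measurable_continuous_on_restrict
      continuous_on_subset[OF continuous_on_norm_on]) (auto simp: sphere_Rn)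

lemma rotation_measurable:
  assumes iso: "\<And>c d. inner_Rn n (q c) (q d) = inner_Rn n c d"
    and meas: "\<And>j. (\<lambda>w. q (coord w) j) \<in> borel_measurable borel"
  shows "(\<lambda>w. recon (q (coord w))) \<in> measurable \<mu> \<mu>"
proof -
  have 1: "(\<lambda>w. recon (q (coord w))) \<in> borel_measurable borel"
  proof (rule measurable_coordinatewise_then_product)
    fix i show "(\<lambda>w. recon (q (coord w)) i) \<in> borel_measurable borel"
      unfolding recon_def by (intro borel_measurable_sum borel_measurable_times meas borel_measurable_const)
  qed
  have 2: "recon (q (coord w)) \<in> unit_sphere n" if "w \<in> unit_sphere n" for w
    using that recon_Rn by (simp add: unit_sphere_def norm_Rn_def inner_recon iso inner_coord)
  have "(\<lambda>w. recon (q (coord w))) \<in> measurable (restrict_space borel (unit_sphere n)) (restrict_space borel (unit_sphere n))"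
    using 2 by (intro measurable_restrict_space2 measurable_restrict_space1 1) (auto simp: space_restrict_space)
  then show ?thesis using measurable_cong_sets[OF sets_mu sets_mu] by blast
qed

text \<open>The isometry \<open>q\<close> acts on coordinates with respect to \<open>x\<close>.
  Conjugating by \<open>coord\<close> and \<open>recon\<close> gives an orthogonal map of the space,
  to which the invariance of \<mu> applies.\<close>

lemma rotation_integral:
  fixes F :: "(nat \<Rightarrow> real) \<Rightarrow> real"
  assumes F: "F \<in> borel_measurable \<mu>"
    and lin: "\<And>c d a b j. q (\<lambda>i. a * c i + b * d i) j = a * q c j + b * q d j"
    and iso: "\<And>c d. inner_Rn n (q c) (q d) = inner_Rn n c d"
    and meas: "\<And>j. (\<lambda>w. q (coord w) j) \<in> borel_measurable borel"
  shows "(\<integral>w. F (recon (q (coord w))) \<partial>\<mu>) = (\<integral>w. F w \<partial>\<mu>)"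
proof -
  let ?T = "\<lambda>w. recon (q (coord w))"
  have "orthogonal_map n ?T"
    unfolding orthogonal_map_def
  proof (intro conjI ballI allI)
    fix u v a b
    have *: "coord (\<lambda>i. a * u i + b * v i) = (\<lambda>j. a * coord u j + b * coord v j)"
      by (simp add: coord_def inner_linear fun_eq_iff)
    show "?T (\<lambda>i. a * u i + b * v i) = (\<lambda>i. a * ?T u i + b * ?T v i)"
      unfolding * recon_def lin by (simp add: fun_eq_iff algebra_simps sum.distrib sum_distrib_left)
  qed (auto simp: recon_Rn inner_recon iso inner_coord)
  then have "distr \<mu> \<mu> ?T = \<mu>" using \<mu> by (simp add: rotation_invariant_prob_def)
  then have "(\<integral>w. F w \<partial>\<mu>) = (\<integral>w. F w \<partial>(distr \<mu> \<mu> ?T))" by simp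
  also have "\<dots> = (\<integral>w. F (?T w) \<partial>\<mu>)"
    by (rule integral_distr[OF rotation_measurable[OF iso meas] F])
  finally show ?thesis by simp
qed

lemma coord_le_1: "w \<in> unit_sphere n \<Longrightarrow> j < n \<Longrightarrow> (coord w j)\<^sup>2 \<le> 1"
  using member_le_sum[of j "{..<n}" "\<lambda>j. (coord w j)\<^sup>2"] sphere_coord[of w] by simp

lemma integrable_coord4: "a < n \<Longrightarrow> b < n \<Longrightarrow> integrable \<mu> (\<lambda>w. (coord w a)\<^sup>2 * (coord w b)\<^sup>2)"
proof -
  assume ab: "a < n" "b < n"
  interpret prob_space \<mu> by (rule prob_mu)
  show ?thesis
  proof (rule integrable_const_bound[of _ 1])
    show "AE w in \<mu>. norm ((coord w a)\<^sup>2 * (coord w b)\<^sup>2) \<le> 1"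
      using coord_le_1 ab by (intro AE_I2) (auto simp: space_mu abs_mult intro!: mult_le_one)
  qed measurable
qed

text \<open>Invariance under the reflection that mixes two coordinates at 45 degrees.\<close>

lemma coord4_pair:
  assumes ab: "a < n" "b < n" "a \<noteq> b"
  shows "6 * (\<integral>w. (coord w a)\<^sup>2 * (coord w b)\<^sup>2 \<partial>\<mu>) =
     (\<integral>w. (coord w a)\<^sup>2 * (coord w a)\<^sup>2 \<partial>\<mu>) + (\<integral>w. (coord w b)\<^sup>2 * (coord w b)\<^sup>2 \<partial>\<mu>)"
proof -
  define r where "r = 1 / sqrt 2"
  have r: "r * r = 1 / 2" by (simp add: r_def)
  define q where "q c j = (if j = a then (c a + c b) * r else if j = b then (c a - c b) * r else c j)"
    for c :: "nat \<Rightarrow> real" and j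
  define F where "F w = (coord w a)\<^sup>2 * (coord w a)\<^sup>2 + (coord w b)\<^sup>2 * (coord w b)\<^sup>2" for w
  note int = integrable_coord4[OF ab(1) ab(1)] integrable_coord4[OF ab(2) ab(2)] integrable_coord4[OF ab(1) ab(2)]
  have split: "(\<Sum>j<n. f j) = f a + f b + (\<Sum>j\<in>{..<n} - {a} - {b}. f j)" for f :: "nat \<Rightarrow> real"
    using ab sum.remove[of "{..<n}" a f] sum.remove[of "{..<n} - {a}" b f] by simp
  have iso: "inner_Rn n (q c) (q d) = inner_Rn n c d" for c d
  proof -
    have "q c a * q d a + q c b * q d b = 2 * (r * r) * (c a * d a + c b * d b)"
      using ab by (simp add: q_def algebra_simps)
    moreover have "(\<Sum>j\<in>{..<n} - {a} - {b}. q c j * q d j) = (\<Sum>j\<in>{..<n} - {a} - {b}. c j * d j)"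
      by (intro sum.cong) (auto simp: q_def)
    ultimately show ?thesis unfolding inner_Rn_def split by (simp add: r)
  qed
  have "(\<integral>w. F (recon (q (coord w))) \<partial>\<mu>) = (\<integral>w. F w \<partial>\<mu>)"
  proof (rule rotation_integral[OF _ _ iso])
    show "F \<in> borel_measurable \<mu>" unfolding F_def[abs_def] by measurable
    show "q (\<lambda>i. s * c i + t * d i) j = s * q c j + t * q d j" for c d s t j
      by (simp add: q_def algebra_simps)
    show "(\<lambda>w. q (coord w) j) \<in> borel_measurable borel" for j
      using measurable_coord unfolding q_def by measurable
  qed
  moreover have "F (recon (q (coord w))) = 1/2 * ((coord w a)\<^sup>2 * (coord w a)\<^sup>2) + 1/2 * ((coord w b)\<^sup>2 * (coord w b)\<^sup>2)
      + 3 * ((coord w a)\<^sup>2 * (coord w b)\<^sup>2)" for w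
  proof -
    \<comment> \<open>The sum of the fourth powers of \<open>a + b\<close> and \<open>a - b\<close>
      is \<open>2 a^4 + 12 a^2 b^2 + 2 b^4\<close>; this is where the mixed moment enters.\<close>
    have "F (recon (q (coord w))) = (r * r) * (r * r) * ((coord w a + coord w b)^4 + (coord w a - coord w b)^4)"
      using ab by (simp add: F_def coord_recon q_def power2_eq_square power4_eq_xxxx algebra_simps)
    also have "\<dots> = 1/2 * ((coord w a)\<^sup>2 * (coord w a)\<^sup>2) + 1/2 * ((coord w b)\<^sup>2 * (coord w b)\<^sup>2)
      + 3 * ((coord w a)\<^sup>2 * (coord w b)\<^sup>2)"
      unfolding r by (simp add: power2_eq_square power4_eq_xxxx algebra_simps)
    finally show ?thesis .
  qed
  ultimately show ?thesis using int by (simp add: F_def)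
qed

text \<open>Summing \<open>coord4_pair\<close> over all pairs, with a correction on the diagonal,
  gives \<open>(2 n + 4) S\<close> for six times the total of the moments. That total is 1, since
  the squared coordinates of a point of the sphere add up to 1.\<close>

lemma coord4_sum: "(\<integral>w. (\<Sum>l<n. (coord w l)\<^sup>2 * (coord w l)\<^sup>2) \<partial>\<mu>) = 3 / (real n + 2)"
proof -
  interpret prob_space \<mu> by (rule prob_mu)
  define m where "m a b = (\<integral>w. (coord w a)\<^sup>2 * (coord w b)\<^sup>2 \<partial>\<mu>)" for a b
  define S where "S = (\<Sum>a<n. m a a)"
  have m: "6 * m a b = m a a + m b b + of_bool (a = b) * (4 * m a a)" if "a < n" "b < n" for a b
    using coord4_pair[OF that] by (cases "a = b") (auto simp: m_def)
  have "(\<Sum>a<n. \<Sum>b<n. m a b) = (\<Sum>a<n. \<integral>w. (\<Sum>b<n. (coord w a)\<^sup>2 * (coord w b)\<^sup>2) \<partial>\<mu>)"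
    unfolding m_def
    by (intro sum.cong refl Bochner_Integration.integral_sum[symmetric] integrable_coord4) auto
  also have "\<dots> = (\<integral>w. (\<Sum>a<n. \<Sum>b<n. (coord w a)\<^sup>2 * (coord w b)\<^sup>2) \<partial>\<mu>)"
    by (intro Bochner_Integration.integral_sum[symmetric] Bochner_Integration.integrable_sum integrable_coord4) auto
  also have "\<dots> = (\<integral>w. 1 \<partial>\<mu>)"
  proof (rule Bochner_Integration.integral_cong[OF refl])
    fix w assume "w \<in> space \<mu>"
    then show "(\<Sum>a<n. \<Sum>b<n. (coord w a)\<^sup>2 * (coord w b)\<^sup>2) = 1"
      using sphere_coord[of w] by (simp add: sum_product[symmetric] space_mu)
  qed
  finally have "6 * (\<Sum>a<n. \<Sum>b<n. m a b) = 6" by (simp add: prob_space)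
  moreover have "6 * (\<Sum>a<n. \<Sum>b<n. m a b) = (\<Sum>a<n. \<Sum>b<n. m a a + m b b + of_bool (a = b) * (4 * m a a))"
    unfolding sum_distrib_left by (intro sum.cong refl m) auto
  moreover have "\<dots> = real n * S + real n * S + 4 * S"
    unfolding sum.distrib S_def
    by (simp add: sum_distrib_left of_bool_def if_distrib[of "\<lambda>x. x * _"] cong: if_cong)
  ultimately have "S = 3 / (real n + 2)" by (simp add: field_simps)
  moreover have "(\<integral>w. (\<Sum>l<n. (coord w l)\<^sup>2 * (coord w l)\<^sup>2) \<partial>\<mu>) = S"
    unfolding S_def m_def by (intro Bochner_Integration.integral_sum integrable_coord4) auto
  ultimately show ?thesis by simp
qed

lemma sum_abs_coord_ge:
  assumes w: "w \<in> unit_sphere n"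
  shows "2 * real n / 3 - (real n)\<^sup>2 / 9 * (\<Sum>l<n. (coord w l)\<^sup>2 * (coord w l)\<^sup>2) \<le> (\<Sum>l<n. \<bar>coord w l\<bar>)\<^sup>2"
proof -
  \<comment> \<open>Up to a factor \<open>n / (n + 2)\<close>, the square of \<open>s\<close> is the
    ratio of the fourth to the second moment of a coordinate.\<close>
  define s where "s = sqrt (3 / real n)"
  have s: "0 < s" "s * s = 3 / real n" using n by (auto simp: s_def)
  define Q where "Q = (\<Sum>l<n. (coord w l)\<^sup>2 * (coord w l)\<^sup>2)"
  define A where "A = (\<Sum>l<n. \<bar>coord w l\<bar>)"
  have "(\<Sum>l<n. 3/2 * ((coord w l)\<^sup>2 / s) - 1/2 * ((coord w l)^4 / s^3)) \<le> A"
    unfolding A_def by (intro sum_mono abs_ge_quartic s)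
  also have "(\<Sum>l<n. 3/2 * ((coord w l)\<^sup>2 / s) - 1/2 * ((coord w l)^4 / s^3))
     = 3/2 * ((\<Sum>l<n. (coord w l)\<^sup>2) / s) - 1/2 * (Q / s^3)"
    by (simp add: Q_def sum_subtractf sum_distrib_left sum_divide_distrib power4_eq_xxxx power2_eq_square mult.assoc)
  finally have A: "3/2 * (1 / s) - 1/2 * (Q / s^3) \<le> A" using sphere_coord[OF w] by simp
  have "2 * (1 / s) * (3/2 * (1 / s) - 1/2 * (Q / s^3)) - (1 / s)\<^sup>2 \<le> 2 * (1 / s) * A - (1 / s)\<^sup>2"
    using s(1) by (intro diff_right_mono mult_left_mono A) auto
  \<comment> \<open>A tangent to the square at \<open>1 / s\<close>. It is linear in
    \<open>A\<close>, so the lower bound for \<open>A\<close> can be inserted whatever its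
    sign.\<close>
  also have "\<dots> \<le> A\<^sup>2"
    using sum_squares_ge_zero[of "A - 1 / s" 0] by (simp add: power2_eq_square algebra_simps)
  also have "2 * (1 / s) * (3/2 * (1 / s) - 1/2 * (Q / s^3)) - (1 / s)\<^sup>2
     = 2 * (1 / (s * s)) - (1 / (s * s))\<^sup>2 * Q"
    using s(1) by (simp add: field_simps power2_eq_square power3_eq_cube)
  finally show ?thesis unfolding s(2) A_def Q_def using n by (simp add: power2_eq_square)
qed

text \<open>By convexity in the shift, each coordinate modulus may be replaced by the mean of all of them.\<close>

lemma sign_average_le:
  assumes N: "norm_on n N"
  shows "sign_average n (\<lambda>\<epsilon>. (N (recon \<epsilon>))\<^sup>2) \<le> 3 * real n * (\<integral>w. (N w)\<^sup>2 \<partial>\<mu>)"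
proof -
  interpret prob_space \<mu> by (rule prob_mu)
  define E where "E = {..<n} \<rightarrow>\<^sub>E {-1, 1 :: real}"
  have finE: "finite E" unfolding E_def by (rule finite_signs)
  have cardE: "card E = 2 ^ n" unfolding E_def by (rule card_signs)
  \<comment> \<open>A cyclic shift of the coordinates followed by sign changes; it is an isometry,
    so each \<open>G s \<epsilon>\<close> has the integral of the squared norm.\<close>
  define q where "q s \<epsilon> c j = \<epsilon> j * c ((j + s) mod n)" for s :: nat and \<epsilon> c :: "nat \<Rightarrow> real" and j
  define G where "G s \<epsilon> w = (N (recon (q s \<epsilon> (coord w))))\<^sup>2" for s \<epsilon> w
  define T where "T = (\<Sum>\<epsilon>\<in>E. (N (recon \<epsilon>))\<^sup>2)"
  define A where "A w = (\<Sum>l<n. \<bar>coord w l\<bar>)" for w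
  have shift: "(\<Sum>j<n. f ((j + s) mod n)) = (\<Sum>j<n. f j)" for f :: "nat \<Rightarrow> real" and s
    by (rule sum.reindex_bij_betw[OF bij_shift_mod])
  have iso: "inner_Rn n (q s \<epsilon> c) (q s \<epsilon> d) = inner_Rn n c d" if "\<epsilon> \<in> E" for s \<epsilon> c d
  proof -
    have "\<epsilon> j * \<epsilon> j = 1" if "j < n" for j using sign_square \<open>\<epsilon> \<in> E\<close> that unfolding E_def by blast
    then have "inner_Rn n (q s \<epsilon> c) (q s \<epsilon> d) = (\<Sum>j<n. c ((j + s) mod n) * d ((j + s) mod n))"
      unfolding inner_Rn_def q_def by (intro sum.cong refl) (simp add: mult.left_commute mult.assoc[symmetric])
    then show ?thesis using shift[of "\<lambda>j. c j * d j"] by (simp add: inner_Rn_def)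
  qed
  have measq: "(\<lambda>w. q s \<epsilon> (coord w) j) \<in> borel_measurable borel" for s \<epsilon> j
    unfolding q_def by (intro borel_measurable_times borel_measurable_const measurable_coord)
  have N_meas: "(\<lambda>w. (N w)\<^sup>2) \<in> borel_measurable \<mu>"
    using measurable_norm_on[OF N] by measurable
  have G_int: "(\<integral>w. G s \<epsilon> w \<partial>\<mu>) = (\<integral>w. (N w)\<^sup>2 \<partial>\<mu>)" if "\<epsilon> \<in> E" for s \<epsilon>
    unfolding G_def
    by (rule rotation_integral[OF N_meas _ iso[OF that] measq]) (simp add: q_def algebra_simps)
  obtain \<alpha> \<beta> where \<beta>: "0 < \<beta>" "\<forall>x\<in>Rn n. \<alpha> * norm_Rn n x \<le> N x \<and> N x \<le> \<beta> * norm_Rn n x"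
    using norm_on_bounds[OF N] by blast
  have G_integrable: "integrable \<mu> (G s \<epsilon>)" if "\<epsilon> \<in> E" for s \<epsilon>
  proof (rule integrable_const_bound[of _ "\<beta>\<^sup>2"])
    show "AE w in \<mu>. norm (G s \<epsilon> w) \<le> \<beta>\<^sup>2"
    proof (rule AE_I2)
      fix w assume "w \<in> space \<mu>"
      then have w: "w \<in> Rn n" "norm_Rn n w = 1" by (simp_all add: space_mu unit_sphere_def)
      have "norm_Rn n (recon (q s \<epsilon> (coord w))) = 1"
        unfolding norm_Rn_def inner_recon iso[OF that] inner_coord[OF w(1) w(1)] using w(2) by (simp add: norm_Rn_def)
      then have "N (recon (q s \<epsilon> (coord w))) \<le> \<beta>" using bspec[OF \<beta>(2) recon_Rn[of "q s \<epsilon> (coord w)"]] by simp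
      then show "norm (G s \<epsilon> w) \<le> \<beta>\<^sup>2"
        unfolding G_def using norm_on_nonneg[OF N recon_Rn] by (simp add: power_mono)
    qed
    show "G s \<epsilon> \<in> borel_measurable \<mu>"
      unfolding G_def[abs_def] by (rule measurable_compose[OF rotation_measurable[OF iso[OF that] measq] N_meas])
  qed
  have recon_cong: "recon c = recon d" if "\<And>j. j < n \<Longrightarrow> c j = d j" for c d
    using that by (simp add: recon_def)
  have N_recon_cong: "(N (recon c))\<^sup>2 = (N (recon d))\<^sup>2" if "\<And>j. j < n \<Longrightarrow> c j = d j" for c d
    by (rule arg_cong[OF recon_cong[OF that]])
  \<comment> \<open>For fixed signs, the vectors with coefficients
    \<open>\<epsilon> j * c s j\<close> add up over the \<open>n\<close> shifts to
    \<open>A w\<close> times the vector with coefficients \<epsilon>. The triangle inequality and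
    Cauchy-Schwarz over the shifts give the estimate, and \<open>sum_signs_abs\<close> removes the
    absolute values.\<close>
  have point: "(A w)\<^sup>2 / real n * T \<le> (\<Sum>s<n. \<Sum>\<epsilon>\<in>E. G s \<epsilon> w)" for w
  proof -
    define c where "c s j = \<bar>coord w ((j + s) mod n)\<bar>" for s j
    have "(A w)\<^sup>2 / real n * (N (recon \<epsilon>))\<^sup>2 \<le> (\<Sum>s<n. (N (recon (\<lambda>j. \<epsilon> j * c s j)))\<^sup>2)" for \<epsilon>
    proof -
      have "A w * N (recon \<epsilon>) = N (\<lambda>i. A w * recon \<epsilon> i)"
        using norm_on_scale[OF N recon_Rn, of "A w" \<epsilon>] by (simp add: A_def sum_nonneg)
      also have "(\<lambda>i. A w * recon \<epsilon> i) = (\<lambda>i. \<Sum>s<n. recon (\<lambda>j. \<epsilon> j * c s j) i)"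
      proof
        fix i
        have "(\<Sum>s<n. c s j) = A w" for j
          using shift[of "\<lambda>l. \<bar>coord w l\<bar>" j] by (simp add: c_def A_def add.commute)
        then have "(\<Sum>j<n. \<epsilon> j * (\<Sum>s<n. c s j) * x j i) = A w * recon \<epsilon> i"
          by (simp add: recon_def sum_distrib_left mult_ac)
        moreover have "(\<Sum>j<n. \<epsilon> j * (\<Sum>s<n. c s j) * x j i) = (\<Sum>s<n. recon (\<lambda>j. \<epsilon> j * c s j) i)"
          unfolding recon_def sum_distrib_left sum_distrib_right by (rule sum.swap)
        ultimately show "A w * recon \<epsilon> i = (\<Sum>s<n. recon (\<lambda>j. \<epsilon> j * c s j) i)" by simp
      qed
      also have "N \<dots> \<le> (\<Sum>s<n. N (recon (\<lambda>j. \<epsilon> j * c s j)))"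
        by (rule norm_on_sum[OF N]) (auto simp: recon_Rn)
      finally have "(A w * N (recon \<epsilon>))\<^sup>2 \<le> (\<Sum>s<n. 1 * N (recon (\<lambda>j. \<epsilon> j * c s j)))\<^sup>2"
        using norm_on_nonneg[OF N recon_Rn] by (intro power_mono mult_nonneg_nonneg) (auto simp: A_def sum_nonneg)
      also have "\<dots> \<le> (\<Sum>s<n. 1\<^sup>2) * (\<Sum>s<n. (N (recon (\<lambda>j. \<epsilon> j * c s j)))\<^sup>2)"
        by (rule Cauchy_Schwarz_ineq_sum)
      finally show ?thesis using n by (simp add: field_simps power_mult_distrib)
    qed
    then have "(A w)\<^sup>2 / real n * T \<le> (\<Sum>\<epsilon>\<in>E. \<Sum>s<n. (N (recon (\<lambda>j. \<epsilon> j * c s j)))\<^sup>2)"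
      unfolding T_def sum_distrib_left by (intro sum_mono)
    also have "\<dots> = (\<Sum>s<n. \<Sum>\<epsilon>\<in>E. (N (recon (\<lambda>j. \<epsilon> j * c s j)))\<^sup>2)" by (rule sum.swap)
    also have "\<dots> = (\<Sum>s<n. \<Sum>\<epsilon>\<in>E. G s \<epsilon> w)"
    proof (rule sum.cong[OF refl])
      fix s
      show "(\<Sum>\<epsilon>\<in>E. (N (recon (\<lambda>j. \<epsilon> j * c s j)))\<^sup>2) = (\<Sum>\<epsilon>\<in>E. G s \<epsilon> w)"
        unfolding E_def G_def q_def c_def
        by (rule sum_signs_abs[of n "\<lambda>c. (N (recon c))\<^sup>2" "\<lambda>j. coord w ((j + s) mod n)", OF N_recon_cong, symmetric])
    qed
    finally show ?thesis .
  qed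
  define Q where "Q w = (\<Sum>l<n. (coord w l)\<^sup>2 * (coord w l)\<^sup>2)" for w
  have T0: "0 \<le> T" by (simp add: T_def sum_nonneg)
  have Q_int: "integrable \<mu> Q" unfolding Q_def[abs_def] by (intro Bochner_Integration.integrable_sum integrable_coord4) auto
  have Q_exp: "(\<integral>w. Q w \<partial>\<mu>) = 3 / (real n + 2)" unfolding Q_def by (rule coord4_sum)
  \<comment> \<open>The mean of \<open>Q\<close> is inserted: the factor of \<open>T\<close> becomes
    \<open>2/3 - 1/3 * (n / (n + 2))\<close>, which is at least 1/3.\<close>
  have "T / 3 \<le> T / real n * (2 * real n / 3 - (real n)\<^sup>2 / 9 * (3 / (real n + 2)))"
  proof -
    have "1 / 3 \<le> 1 / real n * (2 * real n / 3 - (real n)\<^sup>2 / 9 * (3 / (real n + 2)))"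
    proof -
      have "1 / r * (2 * r / 3 - r\<^sup>2 / 9 * (3 / (r + 2))) = 2/3 - 1/3 * (r / (r + 2))" if "0 < r" for r :: real
      proof -
        have "1 / r * (2 * r / 3) = 2/3" "1 / r * (r\<^sup>2 / 9 * (3 / (r + 2))) = 1/3 * (r / (r + 2))"
          using that by (simp_all add: power2_eq_square)
        then show ?thesis by (simp only: right_diff_distrib)
      qed
      moreover have "real n / (real n + 2) \<le> 1" by simp
      ultimately show ?thesis using n by simp
    qed
    then have "T * (1 / 3) \<le> T * (1 / real n * (2 * real n / 3 - (real n)\<^sup>2 / 9 * (3 / (real n + 2))))"
      using T0 by (intro mult_left_mono)
    then show ?thesis by simp
  qed
  also have "\<dots> = (\<integral>w. T / real n * (2 * real n / 3 - (real n)\<^sup>2 / 9 * Q w) \<partial>\<mu>)"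
    unfolding Q_exp[symmetric] using Q_int by (simp add: prob_space)
  also have "\<dots> \<le> (\<integral>w. (\<Sum>s<n. \<Sum>\<epsilon>\<in>E. G s \<epsilon> w) \<partial>\<mu>)"
  proof (rule integral_mono)
    show "integrable \<mu> (\<lambda>w. T / real n * (2 * real n / 3 - (real n)\<^sup>2 / 9 * Q w))" using Q_int by simp
    show "integrable \<mu> (\<lambda>w. \<Sum>s<n. \<Sum>\<epsilon>\<in>E. G s \<epsilon> w)"
      by (intro Bochner_Integration.integrable_sum G_integrable)
    fix w assume "w \<in> space \<mu>"
    then have "T / real n * (2 * real n / 3 - (real n)\<^sup>2 / 9 * Q w) \<le> T / real n * (A w)\<^sup>2"
      unfolding Q_def A_def using T0 by (intro mult_left_mono sum_abs_coord_ge) (auto simp: space_mu)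
    also have "\<dots> \<le> (\<Sum>s<n. \<Sum>\<epsilon>\<in>E. G s \<epsilon> w)" using point[of w] by (simp add: mult.commute)
    finally show "T / real n * (2 * real n / 3 - (real n)\<^sup>2 / 9 * Q w) \<le> (\<Sum>s<n. \<Sum>\<epsilon>\<in>E. G s \<epsilon> w)" .
  qed
  also have "\<dots> = (\<Sum>s<n. \<Sum>\<epsilon>\<in>E. (\<integral>w. (N w)\<^sup>2 \<partial>\<mu>))"
    by (simp add: Bochner_Integration.integral_sum Bochner_Integration.integrable_sum G_integrable G_int)
  also have "\<dots> = real n * 2 ^ n * (\<integral>w. (N w)\<^sup>2 \<partial>\<mu>)" by (simp add: cardE)
  finally have "T / 2 ^ n \<le> 3 * real n * (\<integral>w. (N w)\<^sup>2 \<partial>\<mu>)" by (simp add: field_simps)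
  then show ?thesis by (simp add: sign_average_def T_def E_def)
qed

end

section \<open>Cotype 2 and orthonormal systems\<close>

lemma sum_signs_orthogonal:
  assumes "j < m" "l < m"
  shows "(\<Sum>\<epsilon>\<in>{..<m} \<rightarrow>\<^sub>E {-1, 1 :: real}. \<epsilon> j * \<epsilon> l) = of_bool (j = l) * 2 ^ m"
proof (cases "j = l")
  case True
  then have "(\<Sum>\<epsilon>\<in>{..<m} \<rightarrow>\<^sub>E {-1, 1 :: real}. \<epsilon> j * \<epsilon> l) = (\<Sum>\<epsilon>\<in>{..<m} \<rightarrow>\<^sub>E {-1, 1 :: real}. 1)"
    using sign_square[of _ m l] assms by (intro sum.cong refl) auto
  then show ?thesis using True by (simp add: card_signs)
next
  case False
  define F where "F \<epsilon> = \<epsilon>(j := - \<epsilon> j)" for \<epsilon> :: "nat \<Rightarrow> real"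
  have FE: "F \<epsilon> \<in> {..<m} \<rightarrow>\<^sub>E {-1, 1}" if "\<epsilon> \<in> {..<m} \<rightarrow>\<^sub>E {-1, 1}" for \<epsilon>
    using that assms(1) by (auto simp: F_def PiE_iff extensional_def)
  have FF: "F (F \<epsilon>) = \<epsilon>" for \<epsilon> by (simp add: F_def)
  have "(\<Sum>\<epsilon>\<in>{..<m} \<rightarrow>\<^sub>E {-1, 1 :: real}. \<epsilon> j * \<epsilon> l) = (\<Sum>\<epsilon>\<in>{..<m} \<rightarrow>\<^sub>E {-1, 1 :: real}. - (\<epsilon> j * \<epsilon> l))"
    by (rule sum.reindex_bij_witness[of _ F F]) (use FE FF False in \<open>auto simp: F_def\<close>)
  then show ?thesis using False by (simp add: sum_negf)
qed

text \<open>The generalized parallelogram identity: the mixed terms average to zero. It expresses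
  that the Euclidean norm has cotype 2 with constant 1.\<close>

lemma sign_average_inner:
  "sign_average m (\<lambda>\<epsilon>. inner_Rn n (\<lambda>i. \<Sum>j<m. \<epsilon> j * x j i) (\<lambda>i. \<Sum>j<m. \<epsilon> j * x j i)) = (\<Sum>j<m. inner_Rn n (x j) (x j))"
proof -
  let ?E = "{..<m} \<rightarrow>\<^sub>E {-1, 1 :: real}"
  have "inner_Rn n (\<lambda>i. \<Sum>j<m. \<epsilon> j * x j i) (\<lambda>i. \<Sum>j<m. \<epsilon> j * x j i)
     = (\<Sum>j<m. \<Sum>l<m. (\<epsilon> j * \<epsilon> l) * inner_Rn n (x l) (x j))" for \<epsilon>
    unfolding inner_sum_left by (subst inner_commute, subst inner_sum_left) (simp add: sum_distrib_left mult.assoc)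
  then have "(\<Sum>\<epsilon>\<in>?E. inner_Rn n (\<lambda>i. \<Sum>j<m. \<epsilon> j * x j i) (\<lambda>i. \<Sum>j<m. \<epsilon> j * x j i))
      = (\<Sum>\<epsilon>\<in>?E. \<Sum>j<m. \<Sum>l<m. (\<epsilon> j * \<epsilon> l) * inner_Rn n (x l) (x j))" by simp
  also have "\<dots> = (\<Sum>j<m. \<Sum>\<epsilon>\<in>?E. \<Sum>l<m. (\<epsilon> j * \<epsilon> l) * inner_Rn n (x l) (x j))"
    by (rule sum.swap)
  also have "\<dots> = (\<Sum>j<m. \<Sum>l<m. \<Sum>\<epsilon>\<in>?E. (\<epsilon> j * \<epsilon> l) * inner_Rn n (x l) (x j))"
    by (intro sum.cong refl, rule sum.swap)
  also have "\<dots> = (\<Sum>j<m. \<Sum>l<m. (if l = j then 2 ^ m * inner_Rn n (x j) (x j) else 0))"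
    by (intro sum.cong refl) (auto simp: sum_distrib_right[symmetric] sum_signs_orthogonal)
  also have "\<dots> = 2 ^ m * (\<Sum>j<m. inner_Rn n (x j) (x j))" by (simp add: sum_distrib_left)
  finally show ?thesis by (simp add: sign_average_def)
qed

lemma cotype2_boundD:
  assumes "is_cotype2_bound n K L" "\<And>j. j < m \<Longrightarrow> x j \<in> Rn n"
  shows "1 / L * sqrt (\<Sum>j<m. (body_norm K (x j))\<^sup>2)
    \<le> sqrt (sign_average m (\<lambda>\<epsilon>. (body_norm K (\<lambda>i. \<Sum>j<m. \<epsilon> j * x j i))\<^sup>2))"
  using assms by (simp add: is_cotype2_bound_def)

text \<open>Comparison with the Euclidean norm on both sides of the parallelogram identity. Together
  with \<open>cotype2_bound_ge_1\<close> this makes the infimum defining the cotype constant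
  meaningful.\<close>

lemma cotype2_bound_exists:
  assumes N: "norm_on n (body_norm K)"
  shows "\<exists>L. is_cotype2_bound n K L"
proof -
  let ?N = "body_norm K"
  obtain \<alpha> \<beta> where ab: "0 < \<alpha>" "0 < \<beta>"
      "\<forall>x\<in>Rn n. \<alpha> * norm_Rn n x \<le> ?N x \<and> ?N x \<le> \<beta> * norm_Rn n x"
    using norm_on_bounds[OF N] by blast
  have "is_cotype2_bound n K (\<beta> / \<alpha>)"
    unfolding is_cotype2_bound_def
  proof (intro conjI allI impI)
    fix m and x :: "nat \<Rightarrow> nat \<Rightarrow> real" assume x: "\<forall>j<m. x j \<in> Rn n"
    have lower: "\<alpha>\<^sup>2 * inner_Rn n u u \<le> (?N u)\<^sup>2" if "u \<in> Rn n" for u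
    proof -
      have "(\<alpha> * norm_Rn n u)\<^sup>2 \<le> (?N u)\<^sup>2"
        using bspec[OF ab(3) that] ab(1) norm_Rn_nonneg[of n u] by (intro power_mono) auto
      then show ?thesis by (simp add: power_mult_distrib norm_Rn_sq)
    qed
    have upper: "(?N u)\<^sup>2 \<le> \<beta>\<^sup>2 * inner_Rn n u u" if "u \<in> Rn n" for u
    proof -
      have "(?N u)\<^sup>2 \<le> (\<beta> * norm_Rn n u)\<^sup>2"
        using bspec[OF ab(3) that] norm_on_nonneg[OF N that] by (intro power_mono) auto
      then show ?thesis by (simp add: power_mult_distrib norm_Rn_sq)
    qed
    define S where "S \<epsilon> = (\<lambda>i. \<Sum>j<m. \<epsilon> j * x j i)" for \<epsilon>
    have S: "S \<epsilon> \<in> Rn n" for \<epsilon> unfolding S_def by (rule Rn_closed_ops(4)) (use x in auto)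
    have "(\<alpha> / \<beta>)\<^sup>2 * (\<Sum>j<m. (?N (x j))\<^sup>2) \<le> (\<alpha> / \<beta>)\<^sup>2 * (\<Sum>j<m. \<beta>\<^sup>2 * inner_Rn n (x j) (x j))"
      using x by (intro mult_left_mono sum_mono upper) auto
    also have "\<dots> = \<alpha>\<^sup>2 * (\<Sum>j<m. inner_Rn n (x j) (x j))"
      using ab(2) by (simp add: sum_distrib_left[symmetric] power_divide)
    also have "\<dots> = sign_average m (\<lambda>\<epsilon>. \<alpha>\<^sup>2 * inner_Rn n (S \<epsilon>) (S \<epsilon>))"
      unfolding sign_average_inner[symmetric] S_def[symmetric]
      by (simp add: sign_average_def sum_distrib_left)
    also have "\<dots> \<le> sign_average m (\<lambda>\<epsilon>. (?N (S \<epsilon>))\<^sup>2)"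
      unfolding sign_average_def by (intro divide_right_mono sum_mono lower S) auto
    finally have "sqrt ((\<alpha> / \<beta>)\<^sup>2 * (\<Sum>j<m. (?N (x j))\<^sup>2)) \<le> sqrt (sign_average m (\<lambda>\<epsilon>. (?N (S \<epsilon>))\<^sup>2))"
      by (rule real_sqrt_le_mono)
    then show "1 / (\<beta> / \<alpha>) * sqrt (\<Sum>j<m. (?N (x j))\<^sup>2)
        \<le> sqrt (sign_average m (\<lambda>\<epsilon>. (?N (\<lambda>i. \<Sum>j<m. \<epsilon> j * x j i))\<^sup>2))"
      using ab by (simp add: S_def real_sqrt_mult)
  qed (use ab in simp)
  then show ?thesis by blast
qed

text \<open>A single nonzero vector suffices, since its norm does not change with the sign.\<close>

lemma cotype2_bound_ge_1:
  assumes N: "norm_on n (body_norm K)" and n: "1 \<le> n" and L: "is_cotype2_bound n K L"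
  shows "1 \<le> L"
proof -
  let ?N = "body_norm K"
  define u where "u = (\<lambda>i :: nat. of_bool (i = 0) :: real)"
  have u: "u \<in> Rn n" using n by (auto simp: u_def Rn_iff)
  have "norm_Rn n u = 1" using n inner_basis[of 0 n u] by (simp add: norm_Rn_def u_def)
  moreover obtain \<alpha> \<beta> where ab: "0 < \<alpha>" "\<forall>x\<in>Rn n. \<alpha> * norm_Rn n x \<le> ?N x \<and> ?N x \<le> \<beta> * norm_Rn n x"
    using norm_on_bounds[OF N] by blast
  ultimately have Nu: "0 < ?N u" using bspec[OF ab(2) u] by simp
  have *: "?N (\<lambda>i. \<epsilon> * u i) = ?N u" if "\<epsilon> = 1 \<or> \<epsilon> = -1" for \<epsilon>
    using norm_on_scale[OF N u, of \<epsilon>] that by auto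
  have "sign_average 1 (\<lambda>\<epsilon>. (?N (\<lambda>i. \<Sum>j<1. \<epsilon> j * u i))\<^sup>2) = sign_average 1 (\<lambda>\<epsilon>. (?N u)\<^sup>2)"
    unfolding sign_average_def
  proof (intro arg_cong2[where f = "(/)"] sum.cong refl)
    fix \<epsilon> assume "\<epsilon> \<in> {..<1 :: nat} \<rightarrow>\<^sub>E {-1, 1 :: real}"
    from PiE_mem[OF this, of 0] have "\<epsilon> 0 = 1 \<or> \<epsilon> 0 = -1" by auto
    then have "?N (\<lambda>i. \<epsilon> 0 * u i) = ?N u" by (rule *)
    then show "(?N (\<lambda>i. \<Sum>j<1. \<epsilon> j * u i))\<^sup>2 = (?N u)\<^sup>2" by simp
  qed
  also have "\<dots> = (?N u)\<^sup>2" by (simp add: sign_average_def card_signs)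
  finally have avg: "sign_average 1 (\<lambda>\<epsilon>. (?N (\<lambda>i. \<Sum>j<1. \<epsilon> j * u i))\<^sup>2) = (?N u)\<^sup>2" .
  have L0: "0 < L" using L by (simp add: is_cotype2_bound_def)
  have "1 / L * sqrt (\<Sum>j<1::nat. (?N u)\<^sup>2) \<le> sqrt (sign_average 1 (\<lambda>\<epsilon>. (?N (\<lambda>i. \<Sum>j<1. \<epsilon> j * u i))\<^sup>2))"
    by (rule cotype2_boundD[OF L, of 1 "\<lambda>_. u"]) (rule u)
  then have "1 / L * ?N u \<le> ?N u" unfolding avg using Nu by simp
  then show ?thesis using Nu L0 by (simp add: field_simps)
qed

text \<open>The system is extended to a full orthonormal basis, for which cotype 2 bounds the sum by
  a sign average and \<open>sign_average_le\<close> bounds that average by the spherical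
  mean.\<close>

lemma orthonormal_sum_squares_le:
  assumes \<mu>: "rotation_invariant_prob n \<mu>" and n: "1 \<le> n" and N: "norm_on n (body_norm K)"
    and L: "is_cotype2_bound n K L" and x: "orthonormal_system n m x"
  shows "(\<Sum>j<m. (body_norm K (x j))\<^sup>2) \<le> 3 * real n * L\<^sup>2 * (M_const \<mu> K)\<^sup>2"
proof -
  let ?N = "body_norm K"
  have mn: "m \<le> n" by (rule orthonormal_system_le[OF x])
  obtain y where y: "orthonormal_system n n y" "\<forall>j<m. y j = x j"
    using orthonormal_system_extend[OF x mn] by blast
  have M: "(M_const \<mu> K)\<^sup>2 = (\<integral>w. (?N w)\<^sup>2 \<partial>\<mu>)"
    by (simp add: M_const_def integral_nonneg_AE)
  have L0: "0 < L" using L by (simp add: is_cotype2_bound_def)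
  have "1 / L * sqrt (\<Sum>j<n. (?N (y j))\<^sup>2) \<le> sqrt (sign_average n (\<lambda>\<epsilon>. (?N (\<lambda>i. \<Sum>j<n. \<epsilon> j * y j i))\<^sup>2))"
    by (rule cotype2_boundD[OF L]) (use y(1) in \<open>simp add: orthonormal_system_def\<close>)
  also have "\<dots> \<le> sqrt (3 * real n * (M_const \<mu> K)\<^sup>2)"
    using sign_average_le[OF \<mu> y(1) n N] unfolding recon_def[OF \<mu> y(1) n] M by (rule real_sqrt_le_mono)
  finally have "sqrt (\<Sum>j<n. (?N (y j))\<^sup>2) \<le> L * sqrt (3 * real n * (M_const \<mu> K)\<^sup>2)"
    using L0 by (simp add: field_simps)
  then have "(sqrt (\<Sum>j<n. (?N (y j))\<^sup>2))\<^sup>2 \<le> (L * sqrt (3 * real n * (M_const \<mu> K)\<^sup>2))\<^sup>2"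
    by (intro power_mono) (auto simp: sum_nonneg)
  then have "(\<Sum>j<n. (?N (y j))\<^sup>2) \<le> 3 * real n * L\<^sup>2 * (M_const \<mu> K)\<^sup>2"
    by (simp add: sum_nonneg power_mult_distrib mult_ac)
  moreover have "(\<Sum>j<m. (?N (x j))\<^sup>2) \<le> (\<Sum>j<n. (?N (y j))\<^sup>2)"
  proof -
    have "(\<Sum>j<m. (?N (x j))\<^sup>2) = (\<Sum>j<m. (?N (y j))\<^sup>2)" using y(2) by simp
    also have "\<dots> \<le> (\<Sum>j<n. (?N (y j))\<^sup>2)" using mn by (intro sum_mono2) auto
    finally show ?thesis .
  qed
  ultimately show ?thesis by linarith
qed

text \<open>The size of such a system is at most \<open>n\<close>, so a largest one exists. A vector
  violating the last bound could be normalized and appended to it.\<close>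

lemma maximal_large_system:
  assumes N: "norm_on n N" and a: "0 \<le> a"
  shows "\<exists>k x. orthonormal_system n k x \<and> (\<forall>j<k. a < N (x j)) \<and>
    (\<forall>u\<in>Rn n. (\<forall>j<k. inner_Rn n u (x j) = 0) \<longrightarrow> N u \<le> a * norm_Rn n u)"
proof -
  define P where "P k \<longleftrightarrow> (\<exists>x. orthonormal_system n k x \<and> (\<forall>j<k. a < N (x j)))" for k
  have "P 0" by (simp add: P_def orthonormal_system_def)
  moreover have "k \<le> n" if "P k" for k using that orthonormal_system_le by (auto simp: P_def)
  ultimately obtain k where k: "P k" "\<And>k'. P k' \<Longrightarrow> k' \<le> k"
    using Nat.ex_has_greatest_nat[of P 0 n] by blast
  obtain x where x: "orthonormal_system n k x" "\<forall>j<k. a < N (x j)" using k(1) by (auto simp: P_def)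
  have "N u \<le> a * norm_Rn n u" if u: "u \<in> Rn n" "\<forall>j<k. inner_Rn n u (x j) = 0" for u
  proof (rule ccontr)
    assume less: "\<not> N u \<le> a * norm_Rn n u"
    define s where "s = norm_Rn n u"
    obtain \<alpha> \<beta> where "0 < \<beta>" "\<forall>x\<in>Rn n. \<alpha> * norm_Rn n x \<le> N x \<and> N x \<le> \<beta> * norm_Rn n x"
      using norm_on_bounds[OF N] by blast
    then have "N u \<le> \<beta> * s" using u(1) by (auto simp: s_def)
    then have "s \<noteq> 0" using less by (auto simp: s_def)
    then have s: "0 < s" using norm_Rn_nonneg[of n u] by (simp add: s_def)
    define z where "z = (\<lambda>i. 1 / s * u i)"
    have z: "z \<in> Rn n" unfolding z_def by (rule Rn_closed_ops(3)[OF u(1)])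
    have "inner_Rn n z z = 1 / s * (1 / s * inner_Rn n u u)" unfolding z_def inner_linear ..
    moreover have "inner_Rn n u u = s * s" using norm_Rn_sq[of n u] by (simp add: s_def power2_eq_square)
    ultimately have zz: "inner_Rn n z z = 1" using s by simp
    have zx: "inner_Rn n z (x j) = 0" if "j < k" for j unfolding z_def inner_linear using u(2) that by simp
    have "N z = 1 / s * N u" using norm_on_scale[OF N u(1), of "1 / s"] s by (simp add: z_def)
    then have "N z * s = N u" using s by simp
    then have "a * s < N z * s" using less by (simp add: s_def)
    then have Nz: "a < N z" using s by simp
    have "orthonormal_system n (Suc k) (x(k := z))"
      using orthonormal_system_insert[OF x(1) z zz zx] .
    moreover have "\<forall>j<Suc k. a < N ((x(k := z)) j)" using x(2) Nz by (simp add: less_Suc_eq)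
    ultimately have "P (Suc k)" unfolding P_def by blast
    then show False using k(2)[of "Suc k"] by simp
  qed
  then show ?thesis using x by blast
qed

section \<open>Lifting coordinate vectors\<close>

lemma inner_basis_expansion:
  assumes e: "orthonormal_basis n e" and z: "z \<in> Rn n"
  shows "inner_Rn n w z = (\<Sum>j=1..n. inner_Rn n w (e j) * inner_Rn n z (e j))"
proof -
  have "inner_Rn n z w = inner_Rn n (\<lambda>i. \<Sum>j=1..n. inner_Rn n z (e j) * e j i) w"
    using basis_expansion[OF e z] by simp
  also have "\<dots> = (\<Sum>j=1..n. inner_Rn n z (e j) * inner_Rn n (e j) w)" by (rule inner_sum_left)
  finally show ?thesis by (simp add: inner_commute mult.commute)
qed

lemma Bessel:
  assumes "orthonormal_system n k x"
  shows "(\<Sum>a<k. (inner_Rn n u (x a))\<^sup>2) \<le> inner_Rn n u u"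
proof -
  define b where "b a = inner_Rn n u (x a)" for a
  define s where "s = (\<lambda>i. \<Sum>a<k. b a * x a i)"
  have ss: "inner_Rn n s s = inner_Rn k b b" unfolding s_def by (rule inner_system[OF assms])
  have us: "inner_Rn n s u = inner_Rn k b b"
    unfolding s_def inner_sum_left by (simp add: inner_Rn_def[of k] inner_commute[of n "x _"] b_def)
  have "0 \<le> inner_Rn n (\<lambda>i. u i - s i) (\<lambda>i. u i - s i)" by (rule inner_self_nonneg)
  also have "\<dots> = inner_Rn n u u - inner_Rn k b b"
    using ss us inner_commute[of n u s] by (simp add: inner_linear)
  finally show ?thesis by (simp add: inner_Rn_def[of k] b_def power2_eq_square)
qed

lemma coordinate_lift:
  assumes e: "orthonormal_basis n e" and x: "orthonormal_system n k x"
    and \<theta>: "0 < \<theta>" "\<theta> \<le> 1" and k: "1024 * real k \<le> \<theta> * real n"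
  shows "\<exists>\<tau>\<subseteq>{1..n}. real (card \<tau>) \<le> \<theta> * real n \<and>
    (\<forall>u\<in>Rn n. (\<forall>j\<in>\<tau>. inner_Rn n u (e j) = 0) \<longrightarrow>
      (\<exists>t. (\<forall>a<k. inner_Rn n (\<lambda>i. u i + (\<Sum>j\<in>\<tau>. t j * e j i)) (x a) = 0) \<and>
        (norm_Rn n (\<lambda>i. u i + (\<Sum>j\<in>\<tau>. t j * e j i)))\<^sup>2 \<le> 17 / \<theta> * inner_Rn n u u))"
proof -
  \<comment> \<open>The coordinates, in the system \<open>x\<close>, of the projection of
    \<open>e j\<close> to the span of \<open>x\<close>. Expanding each \<open>x a\<close> in the
    basis \<open>e\<close> shows that these form a tight frame.\<close>
  define v where "v j a = inner_Rn n (x a) (e j)" for j a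
  have xR: "x a \<in> Rn n" if "a < k" for a using x that by (simp add: orthonormal_system_def)
  have tight: "(\<Sum>j\<in>{1..n}. v j a * v j b) = of_bool (a = b)" if "a < k" "b < k" for a b
    using inner_basis_expansion[OF e xR[OF that(2)], of "x a"] x that
    by (simp add: v_def orthonormal_system_def)
  have k': "1024 * real k \<le> \<theta> * real (card {1..n})" using k by simp
  obtain \<tau> where \<tau>: "\<tau> \<subseteq> {1..n}" "real (card \<tau>) \<le> \<theta> * real (card {1..n})"
    "\<And>c. \<theta> / 16 * inner_Rn k c c \<le> (\<Sum>j\<in>\<tau>. (inner_Rn k (v j) c)\<^sup>2)"
    using tight_frame_subset[OF _ tight \<theta> k'] by blast
  have finT: "finite \<tau>" using \<tau>(1) finite_subset by blast
  have pd: "\<theta> / 16 * inner_Rn k c c \<le> bil k (gram \<tau> v 0) c c" for c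
    using \<tau>(3)[of c] by (simp add: bil_gram)
  obtain W where W: "spd_inverse k (gram \<tau> v 0) W"
    using spd_inverse_exists[OF gram_sym pd] \<theta>(1) by auto
  show ?thesis
  proof (intro exI[of _ \<tau>] conjI ballI impI \<tau>(1))
    show "real (card \<tau>) \<le> \<theta> * real n" using \<tau>(2) by simp
    fix u assume u: "u \<in> Rn n" "\<forall>j\<in>\<tau>. inner_Rn n u (e j) = 0"
    define b where "b a = inner_Rn n u (x a)" for a
    \<comment> \<open>The coefficients \<open>t\<close> are sought as inner products of the
      \<open>v j\<close> with one vector \<open>c\<close>. Cancelling the components
      \<open>b\<close> of \<open>u\<close> along \<open>x\<close> is then a linear system for
      \<open>c\<close> with the invertible frame operator of \<tau>.\<close>
    define c where "c = app k W (\<lambda>a. - b a)"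
    define t where "t j = inner_Rn k (v j) c" for j
    define y where "y = (\<lambda>i. \<Sum>j\<in>\<tau>. t j * e j i)"
    have app_c: "app k (gram \<tau> v 0) c a = - b a" if "a < k" for a
      unfolding c_def by (rule app_inverse[OF W that])
    have "inner_Rn n y (x a) = - b a" if a: "a < k" for a
    proof -
      have "inner_Rn n y (x a) = (\<Sum>j\<in>\<tau>. t j * v j a)"
        unfolding y_def inner_sum_left v_def by (simp add: inner_commute)
      also have "\<dots> = (\<Sum>d<k. (\<Sum>j\<in>\<tau>. v j a * v j d) * c d)"
        unfolding t_def inner_Rn_def sum_distrib_right
        by (subst sum.swap) (simp add: mult_ac)
      also have "\<dots> = app k (gram \<tau> v 0) c a" by (simp add: app_def gram_def)
      finally show ?thesis using app_c[OF a] by simp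
    qed
    then have orth: "\<forall>a<k. inner_Rn n (\<lambda>i. u i + y i) (x a) = 0" by (simp add: inner_linear b_def)
    have yy: "inner_Rn n y y = (\<Sum>j\<in>\<tau>. (t j)\<^sup>2)"
    proof -
      have "inner_Rn n (e j) y = t j" if "j \<in> \<tau>" for j
        using inner_basis_sum[OF e \<tau>(1), of j t] that \<tau>(1) by (auto simp: y_def inner_commute)
      then have "(\<Sum>j\<in>\<tau>. t j * inner_Rn n (e j) y) = (\<Sum>j\<in>\<tau>. (t j)\<^sup>2)" by (simp add: power2_eq_square)
      then show ?thesis by (simp add: y_def inner_sum_left)
    qed
    have uy: "inner_Rn n y u = 0"
      unfolding y_def inner_sum_left using u(2) by (intro sum.neutral) (auto simp: inner_commute)
    define Y where "Y = inner_Rn n y y"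
    define B where "B = inner_Rn k b b"
    have Y0: "0 \<le> Y" unfolding Y_def by (rule inner_self_nonneg)
    have B0: "0 \<le> B" unfolding B_def by (rule inner_self_nonneg)
    have Yc: "\<theta> / 16 * inner_Rn k c c \<le> Y" using \<tau>(3)[of c] by (simp add: Y_def yy t_def)
    have Yb: "Y = - inner_Rn k c b"
    proof -
      have "Y = bil k (gram \<tau> v 0) c c" by (simp add: Y_def yy t_def bil_gram)
      also have "\<dots> = inner_Rn k c (\<lambda>a. - 1 * b a)" unfolding bil_def by (rule inner_cong) (auto simp: app_c)
      also have "\<dots> = - inner_Rn k c b" unfolding inner_linear by simp
      finally show ?thesis .
    qed
    \<comment> \<open>\<open>Y\<close> equals the form of the frame operator at \<open>c\<close> and
      also minus the inner product of \<open>c\<close> and \<open>b\<close>. The lower frame bound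
      controls \<open>c\<close> by \<open>Y\<close>, so after Cauchy-Schwarz one factor
      \<open>Y\<close> cancels.\<close>
    have "Y\<^sup>2 \<le> inner_Rn k c c * B"
      using inner_Cauchy_Schwarz[of k c b] by (simp add: Yb B_def)
    also have "\<dots> \<le> (16 / \<theta> * Y) * B"
      using Yc \<theta>(1) B0 by (intro mult_right_mono) (auto simp: field_simps)
    finally have *: "Y * Y \<le> (16 / \<theta> * B) * Y" by (simp add: power2_eq_square mult_ac)
    have "Y \<le> 16 / \<theta> * B"
    proof (cases "Y = 0")
      case True
      have "0 \<le> 16 / \<theta> * B" using \<theta>(1) B0 by simp
      then show ?thesis using True by simp
    next
      case False
      then have "0 < Y" using Y0 by simp
      then show ?thesis using * by (rule mult_right_le_imp_le[rotated])
    qed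
    also have "\<dots> \<le> 16 / \<theta> * inner_Rn n u u"
      using Bessel[OF x, of u] \<theta>(1) by (intro mult_left_mono) (auto simp: B_def b_def inner_Rn_def[of k] power2_eq_square)
    finally have "Y \<le> 16 / \<theta> * inner_Rn n u u" .
    \<comment> \<open>The part \<open>u\<close> is orthogonal to the correction; its own square is
      the 17th unit in the constant.\<close>
    moreover have "1 * inner_Rn n u u \<le> 1 / \<theta> * inner_Rn n u u"
      using \<theta> inner_self_nonneg[of n u] by (intro mult_right_mono) auto
    moreover have "17 / \<theta> * inner_Rn n u u = 16 / \<theta> * inner_Rn n u u + 1 / \<theta> * inner_Rn n u u"
      by (simp add: field_simps)
    moreover have "(norm_Rn n (\<lambda>i. u i + y i))\<^sup>2 = inner_Rn n u u + Y"
      using uy inner_commute[of n u y] by (simp add: norm_Rn_sq inner_linear Y_def)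
    ultimately have "(norm_Rn n (\<lambda>i. u i + y i))\<^sup>2 \<le> 17 / \<theta> * inner_Rn n u u" by linarith
    then show "\<exists>t. (\<forall>a<k. inner_Rn n (\<lambda>i. u i + (\<Sum>j\<in>\<tau>. t j * e j i)) (x a) = 0) \<and>
        (norm_Rn n (\<lambda>i. u i + (\<Sum>j\<in>\<tau>. t j * e j i)))\<^sup>2 \<le> 17 / \<theta> * inner_Rn n u u"
      using orth unfolding y_def by blast
  qed
qed

lemma coordinate_projection:
  assumes n: "1 \<le> n" and \<mu>: "rotation_invariant_prob n \<mu>" and K: "symmetric_convex_body n K"
    and e: "orthonormal_basis n e" and \<theta>: "0 < \<theta>" "\<theta> < 1"
  defines "\<rho> \<equiv> 1 / 4000 * \<theta> / ((ln (2 / \<theta>))\<^sup>2 * h (cotype2_const n K) * M_const \<mu> K)"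
  shows "\<exists>\<sigma>. \<sigma> \<subseteq> {1..n} \<and> real (card \<sigma>) \<ge> (1 - \<theta>) * real n \<and>
    orth_proj n (coord_subspace n e \<sigma>) ` K \<supseteq> (\<lambda>x i. \<rho> * x i) ` (unit_ball n \<inter> coord_subspace n e \<sigma>)"
proof -
  let ?N = "body_norm K"
  define C where "C = cotype2_const n K"
  define M where "M = M_const \<mu> K"
  have N: "norm_on n ?N" by (rule norm_on_body_norm[OF K])
  have ne: "{L. is_cotype2_bound n K L} \<noteq> {}" using cotype2_bound_exists[OF N] by blast
  have C1: "1 \<le> C"
    unfolding C_def cotype2_const_def using ne cotype2_bound_ge_1[OF N n] by (intro cInf_greatest) auto
  \<comment> \<open>A bound within a factor 2 of the infimum avoids showing that the infimum is
    attained.\<close>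
  have "Inf {L. is_cotype2_bound n K L} < 2 * C" using C1 by (simp add: C_def cotype2_const_def[symmetric])
  then obtain L where L: "is_cotype2_bound n K L" "L < 2 * C" using cInf_lessD[OF ne] by blast
  have L1: "1 \<le> L" by (rule cotype2_bound_ge_1[OF N n L(1)])
  have M0: "0 \<le> M" by (simp add: M_def M_const_def integral_nonneg_AE)
  \<comment> \<open>3072 is 3 times 1024: the bound 3 comes from
    \<open>orthonormal_sum_squares_le\<close>, and 1024 is the ratio required by
    \<open>coordinate_lift\<close>.\<close>
  define a where "a = sqrt (3072 / \<theta>) * L * M"
  have a0: "0 \<le> a" using \<theta> L1 M0 by (simp add: a_def)
  obtain k x where x: "orthonormal_system n k x" "\<forall>j<k. a < ?N (x j)"
      "\<forall>u\<in>Rn n. (\<forall>j<k. inner_Rn n u (x j) = 0) \<longrightarrow> ?N u \<le> a * norm_Rn n u"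
    using maximal_large_system[OF N a0] by blast
  \<comment> \<open>Positivity of \<open>M\<close> is not established beforehand. If
    \<open>M = 0\<close>, the sum of squares vanishes while each member has positive norm, so the
    system is empty.\<close>
  have k: "1024 * real k \<le> \<theta> * real n"
  proof (cases "M = 0 \<or> k = 0")
    case True
    have "k = 0"
    proof (rule ccontr)
      assume k: "k \<noteq> 0"
      then have "M = 0" using True by simp
      then have "(\<Sum>j<k. (?N (x j))\<^sup>2) \<le> 0"
        using orthonormal_sum_squares_le[OF \<mu> n N L(1) x(1)] by (simp add: M_def)
      moreover have "(?N (x 0))\<^sup>2 \<le> (\<Sum>j<k. (?N (x j))\<^sup>2)"
        using k by (intro member_le_sum[where f = "\<lambda>j. (?N (x j))\<^sup>2"]) auto
      ultimately have "(?N (x 0))\<^sup>2 \<le> 0" by linarith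
      moreover have "0 < ?N (x 0)" using x(2) k a0 by (metis le_less_trans not_gr_zero)
      ultimately show False by simp
    qed
    then show ?thesis using \<theta> by simp
  next
    case False
    then have M: "0 < M" using M0 by simp
    have "real k * a\<^sup>2 = (\<Sum>j<k. a\<^sup>2)" by simp
    also have "\<dots> \<le> (\<Sum>j<k. (?N (x j))\<^sup>2)"
      using x(2) a0 by (intro sum_mono power_mono) auto
    also have "\<dots> \<le> 3 * real n * L\<^sup>2 * M\<^sup>2"
      unfolding M_def by (rule orthonormal_sum_squares_le[OF \<mu> n N L(1) x(1)])
    finally have "real k * (3072 / \<theta> * (L\<^sup>2 * M\<^sup>2)) \<le> (3 * real n) * (L\<^sup>2 * M\<^sup>2)"
      using \<theta> by (simp add: a_def power_mult_distrib mult.assoc)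
    then have "(real k * (3072 / \<theta>)) * (L\<^sup>2 * M\<^sup>2) \<le> (3 * real n) * (L\<^sup>2 * M\<^sup>2)" by (simp only: mult.assoc)
    moreover have "0 < L\<^sup>2 * M\<^sup>2" using L1 M by simp
    ultimately have "real k * (3072 / \<theta>) \<le> 3 * real n" by (rule mult_right_le_imp_le)
    then show ?thesis using \<theta> by (simp add: field_simps)
  qed
  obtain \<tau> where \<tau>: "\<tau> \<subseteq> {1..n}" "real (card \<tau>) \<le> \<theta> * real n"
    "\<forall>u\<in>Rn n. (\<forall>j\<in>\<tau>. inner_Rn n u (e j) = 0) \<longrightarrow>
      (\<exists>t. (\<forall>a<k. inner_Rn n (\<lambda>i. u i + (\<Sum>j\<in>\<tau>. t j * e j i)) (x a) = 0) \<and>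
        (norm_Rn n (\<lambda>i. u i + (\<Sum>j\<in>\<tau>. t j * e j i)))\<^sup>2 \<le> 17 / \<theta> * inner_Rn n u u)"
    using coordinate_lift[OF e x(1) \<theta>(1) less_imp_le[OF \<theta>(2)] k] by blast
  define \<sigma> where "\<sigma> = {1..n} - \<tau>"
  have \<sigma>: "\<sigma> \<subseteq> {1..n}" by (auto simp: \<sigma>_def)
  have eR: "e j \<in> Rn n" if "j \<in> \<tau>" for j using e \<tau>(1) that by (auto simp: orthonormal_basis_def)
  have card: "(1 - \<theta>) * real n \<le> real (card \<sigma>)"
  proof -
    have "card \<tau> \<le> n" using card_mono[OF _ \<tau>(1)] by simp
    then have "real (card \<sigma>) = real n - real (card \<tau>)"
      using \<tau>(1) by (simp add: \<sigma>_def card_Diff_subset finite_subset of_nat_diff)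
    then show ?thesis using \<tau>(2) by (simp add: algebra_simps)
  qed
  \<comment> \<open>For \<open>M = 0\<close> division by zero makes \<rho> equal to 0. Otherwise
    \<open>a * sqrt (17 / \<theta>)\<close> is at most \<open>458 C M / \<theta>\<close>, from
    \<open>sqrt 52224 < 229\<close> and \<open>L < 2 C\<close>. Both logarithms are at least 1/2, so
    the product is at most \<open>458 * 8 / 4000 < 1\<close>.\<close>
  have \<rho>a: "0 \<le> \<rho>" "\<rho> * (a * sqrt (17 / \<theta>)) \<le> 1"
  proof -
    define l where "l = ln (2 / \<theta>)"
    define c where "c = ln (2 * C)"
    have l: "1/2 \<le> l"
    proof -
      have "ln 2 \<le> l" unfolding l_def using \<theta> by (subst ln_le_cancel_iff) (auto simp: field_simps)
      then show ?thesis using ln2_ge_two_thirds by linarith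
    qed
    have c: "1/2 \<le> c"
    proof -
      have "ln 2 \<le> c" unfolding c_def using C1 by (subst ln_le_cancel_iff) auto
      then show ?thesis using ln2_ge_two_thirds by linarith
    qed
    have \<rho>: "\<rho> = 1 / 4000 * \<theta> / (l\<^sup>2 * (C * c) * M)"
      by (simp add: \<rho>_def l_def c_def h_def C_def M_def)
    show "0 \<le> \<rho>" unfolding \<rho> using \<theta> C1 c M0 by simp
    show "\<rho> * (a * sqrt (17 / \<theta>)) \<le> 1"
    proof (cases "M = 0")
      case True then show ?thesis by (simp add: \<rho>)
    next
      case False
      then have M: "0 < M" using M0 by simp
      have "sqrt (3072 / \<theta>) * sqrt (17 / \<theta>) = sqrt (52224 / \<theta>\<^sup>2)"
        by (simp add: real_sqrt_mult[symmetric] power2_eq_square)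
      also have "\<dots> = sqrt 52224 / \<theta>" using \<theta> by (simp add: real_sqrt_divide)
      also have "\<dots> \<le> 229 / \<theta>"
        using \<theta> by (intro divide_right_mono real_le_lsqrt) auto
      finally have s: "sqrt (3072 / \<theta>) * sqrt (17 / \<theta>) \<le> 229 / \<theta>" .
      have "a * sqrt (17 / \<theta>) = (sqrt (3072 / \<theta>) * sqrt (17 / \<theta>)) * L * M" by (simp add: a_def)
      also have "\<dots> \<le> 229 / \<theta> * (2 * C) * M"
        using s L(2) L1 M \<theta> C1 by (intro mult_right_mono mult_mono) auto
      finally have as: "a * sqrt (17 / \<theta>) \<le> 458 * C * M / \<theta>" by simp
      have lc: "1 / 8 \<le> l\<^sup>2 * c"
      proof -
        have "(1/2)\<^sup>2 * (1/2) \<le> l\<^sup>2 * c" using l c by (intro mult_mono power_mono) auto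
        then show ?thesis by (simp add: power2_eq_square)
      qed
      have "\<rho> * (a * sqrt (17 / \<theta>)) \<le> \<rho> * (458 * C * M / \<theta>)"
        using as \<open>0 \<le> \<rho>\<close> by (intro mult_left_mono)
      also have "\<dots> = 458 / 4000 / (l\<^sup>2 * c)"
        unfolding \<rho> using \<theta> C1 M l c by (simp add: field_simps)
      also have "\<dots> \<le> 458 / 4000 / (1 / 8)" using lc by (intro divide_left_mono) auto
      finally show ?thesis by simp
    qed
  qed
  have "(\<lambda>i. \<rho> * u i) \<in> orth_proj n (coord_subspace n e \<sigma>) ` K"
    if u: "u \<in> unit_ball n" "u \<in> coord_subspace n e \<sigma>" for u
  proof -
    have uR: "u \<in> Rn n" and u1: "inner_Rn n u u \<le> 1"
      using u(1) by (auto simp: unit_ball_def norm_Rn_def)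
    have u\<tau>: "inner_Rn n u (e j) = 0" if "j \<in> \<tau>" for j
      using u(2) that \<tau>(1) by (auto simp: coord_subspace_def \<sigma>_def)
    obtain t where t: "\<forall>a<k. inner_Rn n (\<lambda>i. u i + (\<Sum>j\<in>\<tau>. t j * e j i)) (x a) = 0"
        "(norm_Rn n (\<lambda>i. u i + (\<Sum>j\<in>\<tau>. t j * e j i)))\<^sup>2 \<le> 17 / \<theta> * inner_Rn n u u"
      using bspec[OF \<tau>(3) uR] u\<tau> by blast
    define y where "y = (\<lambda>i. \<Sum>j\<in>\<tau>. t j * e j i)"
    define w where "w = (\<lambda>i. u i + y i)"
    have yR: "y \<in> Rn n" unfolding y_def by (rule Rn_closed_ops(4)) (rule eR)
    have wR: "w \<in> Rn n" unfolding w_def by (rule Rn_closed_ops(1)[OF uR yR])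
    have "(norm_Rn n w)\<^sup>2 \<le> 17 / \<theta> * inner_Rn n u u" using t(2) by (simp add: w_def y_def)
    also have "\<dots> \<le> 17 / \<theta> * 1" using u1 \<theta> by (intro mult_left_mono) auto
    finally have "norm_Rn n w \<le> sqrt (17 / \<theta>)" by (intro real_le_rsqrt) simp
    then have "a * norm_Rn n w \<le> a * sqrt (17 / \<theta>)" using a0 by (intro mult_left_mono)
    moreover have "?N w \<le> a * norm_Rn n w" using x(3) wR t(1) by (simp add: w_def y_def)
    ultimately have "\<rho> * ?N w \<le> \<rho> * (a * sqrt (17 / \<theta>))" using \<rho>a(1) by (intro mult_left_mono) auto
    then have "?N (\<lambda>i. \<rho> * w i) \<le> 1" using \<rho>a norm_on_scale[OF N wR, of \<rho>] by simp
    then have wK: "(\<lambda>i. \<rho> * w i) \<in> K"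
      by (rule body_norm_le_1[OF K Rn_closed_ops(3)[OF wR]])
    \<comment> \<open>The correction \<open>y\<close> is spanned by basis vectors with index in
      \<tau>, so projecting to the coordinates in \<sigma> recovers \<open>u\<close>.\<close>
    have "inner_Rn n (\<lambda>i. \<rho> * w i) (e j) = \<rho> * inner_Rn n u (e j)" if "j \<in> \<sigma>" for j
    proof -
      have "inner_Rn n y (e j) = 0"
        unfolding y_def using inner_basis_sum[OF e \<tau>(1), of j t] that by (simp add: \<sigma>_def)
      then show ?thesis by (simp add: w_def inner_linear)
    qed
    then have "orth_proj n (coord_subspace n e \<sigma>) (\<lambda>i. \<rho> * w i) = (\<lambda>i. \<Sum>j\<in>\<sigma>. \<rho> * inner_Rn n u (e j) * e j i)"
      unfolding orth_proj_coord_subspace[OF e \<sigma> Rn_closed_ops(3)[OF wR]] by simp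
    also have "\<dots> = (\<lambda>i. \<rho> * u i)"
    proof
      fix i
      have "u i = (\<Sum>j=1..n. inner_Rn n u (e j) * e j i)"
        using fun_cong[OF basis_expansion[OF e uR], of i] .
      also have "\<dots> = (\<Sum>j\<in>\<sigma>. inner_Rn n u (e j) * e j i)"
        by (rule sum.mono_neutral_right) (use u\<tau> \<sigma> in \<open>auto simp: \<sigma>_def\<close>)
      finally show "(\<Sum>j\<in>\<sigma>. \<rho> * inner_Rn n u (e j) * e j i) = \<rho> * u i"
        by (simp add: sum_distrib_left mult.assoc)
    qed
    finally show ?thesis using wK by (metis imageI)
  qed
  then show ?thesis using \<sigma> card by (intro exI[of _ \<sigma>]) auto
qed

theorem theoremC:
  shows "\<exists>c1::real. c1 > 0 \<and>
    (\<forall>(n::nat) (\<mu> :: (nat \<Rightarrow> real) measure) (K :: (nat \<Rightarrow> real) set)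
      (e :: nat \<Rightarrow> nat \<Rightarrow> real) (\<theta>::real).
      n \<ge> 1 \<longrightarrow>
      rotation_invariant_prob n \<mu> \<longrightarrow>
      symmetric_convex_body n K \<longrightarrow>
      orthonormal_basis n e \<longrightarrow>
      0 < \<theta> \<and> \<theta> < 1 \<longrightarrow>
      (\<exists>\<sigma>. \<sigma> \<subseteq> {1..n} \<and> real (card \<sigma>) \<ge> (1 - \<theta>) * real n \<and>
        orth_proj n (coord_subspace n e \<sigma>) ` K \<supseteq>
          (\<lambda>x i. (c1 * \<theta> / ((ln (2 / \<theta>))\<^sup>2 * h (cotype2_const n K) * M_const \<mu> K)) * x i)
            ` (unit_ball n \<inter> coord_subspace n e \<sigma>)))"
  by (intro exI[of _ "1 / 4000"] conjI allI impI coordinate_projection) auto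

end
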